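(* Let $n\geq 1$ be an integer. The restrictions to $\mathbb{CL}(n-1)$ of the Kronecker products of irreducible representations of the Clifford group $\mathbb{CL}(n)$ decompose, up to equivalence, as follows, where $A,B\subseteq X_n$ are arbitrary: (1) $\mathrm{Res}^{\mathbb{CL}(n)}_{\mathbb{CL}(n-1)}(\chi_A\otimes\chi_B)=\chi_{(A\triangle B)\setminus\{n\}}$; (2) if $n$ is even, $\mathrm{Res}^{\mathbb{CL}(n)}_{\mathbb{CL}(n-1)}(\chi_A\otimes\rho_n)=\rho_{n-1}^{+}\oplus\rho_{n-1}^{-}$; (3) if $n$ is odd, $\mathrm{Res}^{\mathbb{CL}(n)}_{\mathbb{CL}(n-1)}(\chi_A\otimes\rho_n^{\pm})=\rho_{n-1}$; (4) if $n$ is even, $\mathrm{Res}^{\mathbb{CL}(n)}_{\mathbb{CL}(n-1)}(\rho_n\otimes\rho_n)=2\bigoplus_{C\subseteq X_{n-1}}\chi_C$ (each $\chi_C$ occurring with multiplicity exactly $2$); (5) if $n$ is odd, $\mathrm{Res}^{\mathbb{CL}(n)}_{\mathbb{CL}(n-1)}(\rho_n^{\pm}\otimes\rho_n^{\pm})=\mathrm{Res}^{\mathbb{CL}(n)}_{\mathbb{CL}(n-1)}(\rho_n^{\pm}\otimes\rho_n^{\mp})=\bigoplus_{C\subseteq X_{n-1}}\chi_C$.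
   Context: For $n\geq 0$ let $X_n=\{1,2,\ldots,n\}$ (so $X_0=\varnothing$). The Clifford group of degree $n$ is the group $\mathbb{CL}(n)=\{\pm\gamma_A : A\subseteq X_n\}$ of order $2^{n+1}$ (the elements $\varepsilon\gamma_A$, $\varepsilon=\pm1$, $A\subseteq X_n$, being pairwise distinct formal symbols), with multiplication $\varepsilon_1\gamma_A\cdot\varepsilon_2\gamma_B=\varepsilon_1\varepsilon_2(-1)^{\xi(A,B)}\gamma_{A\triangle B}$, where $A\triangle B$ is the symmetric difference and $\xi(A,B)$ is the number of pairs $(a,b)\in A\times B$ with $a>b$. The identity is $\gamma_\varnothing$. For $n\geq 1$, $\mathbb{CL}(n-1)$ is regarded as the subgroup $\{\pm\gamma_A : A\subseteq X_{n-1}\}$ of $\mathbb{CL}(n)$. It is known that the irreducible complex representations of $\mathbb{CL}(n)$ are, up to equivalence, the following (each determined by its character). There are $2^n$ one-dimensional representations $\chi_A$, $A\subseteq X_n$, given by $\chi_A(\pm\gamma_B)=(-1)^{|A\cap B|}$. If $n$ is even there is exactly one further irreducible representation $\rho_n$, of dimension $2^{n/2}$, with character $\chi_{\rho_n}(\pm\gamma_B)=\pm\delta_{B,\varnothing}2^{n/2}$. If $n=2m+1$ is odd there are exactly two further irreducible representations $\rho_n^{+},\rho_n^{-}$, of dimension $2^m$, with characters $\chi_{\rho_n^\pm}(\gamma_\varnothing)=2^m$, $\chi_{\rho_n^\pm}(\gamma_{X_n})=\pm c\,2^m$, $\chi_{\rho_n^\pm}(\gamma_B)=0$ for $B\neq\varnothing,X_n$,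 and $\chi_{\rho_n^\pm}(-\gamma_B)=-\chi_{\rho_n^\pm}(\gamma_B)$ for all $B$, where $c=1$ if $m$ is even and $c=-i$ if $m$ is odd. $\otimes$ denotes the inner (Kronecker) tensor product of representations, $g\mapsto\rho(g)\otimes\sigma(g)$, and $\mathrm{Res}$ denotes restriction to a subgroup. The symbols $\chi_C$, $\rho_{n-1}$, $\rho_{n-1}^\pm$ on the right-hand sides are the corresponding representations of $\mathbb{CL}(n-1)$. *)

theory Defs
  imports "Jordan_Normal_Form.VS_Connect" "HOL-Algebra.Coset"
begin

section \<open>The Clifford groups\<close>

definition X_set :: "nat \<Rightarrow> nat set" where
  "X_set n = {1..n}"

definition xi :: "nat set \<Rightarrow> nat set \<Rightarrow> nat" where
  "xi A B = card {(a, b) \<in> A \<times> B. a > b}"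

text \<open>The pair \<open>(\<epsilon>, A)\<close> with \<open>\<epsilon> = \<plusminus>1\<close> stands for the formal symbol \<open>\<epsilon> \<gamma>\<^sub>A\<close>. With this encoding
  the inclusion of \<open>CL (n - 1)\<close> into \<open>CL n\<close> is literally an inclusion of carriers.\<close>

definition CL :: "nat \<Rightarrow> (int \<times> nat set) monoid" where
  "CL n = \<lparr>carrier = {1, -1} \<times> Pow (X_set n),
           mult = (\<lambda>(e1, A) (e2, B). (e1 * e2 * (-1) ^ xi A B, sym_diff A B)),
           one = (1, {})\<rparr>"

section \<open>Matrix representations\<close>

definition representation :: "('g, 'b) monoid_scheme \<Rightarrow> nat \<Rightarrow> ('g \<Rightarrow> complex mat) \<Rightarrow> bool" where
  "representation G d \<rho> \<longleftrightarrow> \<rho> \<in> hom G (units_of (ring_mat TYPE(complex) d ()))"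

definition irreducible_rep :: "('g, 'b) monoid_scheme \<Rightarrow> nat \<Rightarrow> ('g \<Rightarrow> complex mat) \<Rightarrow> bool" where
  "irreducible_rep G d \<rho> \<longleftrightarrow>
     representation G d \<rho> \<and> d > 0 \<and>
     (\<forall>W. VectorSpace.subspace class_ring W (module_vec TYPE(complex) d) \<and>
          (\<forall>g\<in>carrier G. \<forall>w\<in>W. \<rho> g *\<^sub>v w \<in> W)
        \<longrightarrow> W = {0\<^sub>v d} \<or> W = carrier_vec d)"

text \<open>Equivalence requires one base change, the same for all group elements; \<open>similar_mat_wit\<close>
  makes both sides square of the same size. The values outside \<open>carrier G\<close> are irrelevant.\<close>

definition rep_equiv :: "('g, 'b) monoid_scheme \<Rightarrow> ('g \<Rightarrow> complex mat) \<Rightarrow> ('g \<Rightarrow> complex mat) \<Rightarrow> bool" where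
  "rep_equiv G \<rho> \<sigma> \<longleftrightarrow> (\<exists>P Q. \<forall>g\<in>carrier G. similar_mat_wit (\<rho> g) (\<sigma> g) P Q)"

definition Res :: "('g, 'b) monoid_scheme \<Rightarrow> ('g \<Rightarrow> complex mat) \<Rightarrow> 'g \<Rightarrow> complex mat" where
  "Res H \<rho> = restrict \<rho> (carrier H)"

definition kronecker :: "complex mat \<Rightarrow> complex mat \<Rightarrow> complex mat" where
  "kronecker M N = mat (dim_row M * dim_row N) (dim_col M * dim_col N)
     (\<lambda>(i, j). M $$ (i div dim_row N, j div dim_col N) * N $$ (i mod dim_row N, j mod dim_col N))"

definition rep_tensor :: "('g \<Rightarrow> complex mat) \<Rightarrow> ('g \<Rightarrow> complex mat) \<Rightarrow> 'g \<Rightarrow> complex mat" where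
  "rep_tensor \<rho> \<sigma> = (\<lambda>g. kronecker (\<rho> g) (\<sigma> g))"

definition rep_sum :: "('g \<Rightarrow> complex mat) list \<Rightarrow> 'g \<Rightarrow> complex mat" where
  "rep_sum \<rho>s = (\<lambda>g. diag_block_mat (map (\<lambda>\<rho>. \<rho> g) \<rho>s))"

definition mat_trace :: "complex mat \<Rightarrow> complex" where
  "mat_trace M = (\<Sum>i<dim_row M. M $$ (i, i))"

definition character :: "('g \<Rightarrow> complex mat) \<Rightarrow> 'g \<Rightarrow> complex" where
  "character \<rho> g = mat_trace (\<rho> g)"

section \<open>The irreducible representations of the Clifford groups\<close>

definition chi :: "nat set \<Rightarrow> int \<times> nat set \<Rightarrow> complex mat" where
  "chi A = (\<lambda>(e, B). mat 1 1 (\<lambda>_. (-1) ^ card (A \<inter> B)))"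

text \<open>The higher-dimensional irreducible representations are only given up to equivalence. So
  \<open>is_rho n \<rho>\<close> says that \<open>\<rho>\<close> is a representative of the class \<open>\<rho>\<^sub>n\<close> (\<open>n\<close> even), and \<open>is_rho_pm n s \<rho>\<close>
  that \<open>\<rho>\<close> is a representative of the class \<open>\<rho>\<^sub>n\<^sup>+\<close> (\<open>s = 1\<close>) or \<open>\<rho>\<^sub>n\<^sup>-\<close> (\<open>s = -1\<close>) (\<open>n\<close> odd).\<close>

definition is_rho :: "nat \<Rightarrow> (int \<times> nat set \<Rightarrow> complex mat) \<Rightarrow> bool" where
  "is_rho n \<rho> \<longleftrightarrow>
     irreducible_rep (CL n) (2 ^ (n div 2)) \<rho> \<and>
     (\<forall>e\<in>{1, -1}. \<forall>B\<subseteq>X_set n.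
        character \<rho> (e, B) = of_int e * (if B = {} then 2 ^ (n div 2) else 0))"

definition is_rho_pm :: "nat \<Rightarrow> int \<Rightarrow> (int \<times> nat set \<Rightarrow> complex mat) \<Rightarrow> bool" where
  "is_rho_pm n s \<rho> \<longleftrightarrow>
     (let m = (n - 1) div 2; c = (if even m then 1 else - \<i>) in
        irreducible_rep (CL n) (2 ^ m) \<rho> \<and>
        character \<rho> (1, {}) = 2 ^ m \<and>
        character \<rho> (1, X_set n) = of_int s * c * 2 ^ m \<and>
        (\<forall>B\<subseteq>X_set n. B \<noteq> {} \<and> B \<noteq> X_set n \<longrightarrow> character \<rho> (1, B) = 0) \<and>
        (\<forall>B\<subseteq>X_set n. character \<rho> (-1, B) = - character \<rho> (1, B)))"

definition chi_sum :: "nat \<Rightarrow> int \<times> nat set \<Rightarrow> complex mat" where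
  "chi_sum n = rep_sum (map (\<lambda>Cs. chi (set Cs)) (subseqs [1..<Suc n]))"

section \<open>Basic facts\<close>

text \<open>The list in \<open>chi_sum\<close> runs through every subset of \<open>X_set n\<close> exactly once.\<close>

lemma chi_sum_index:
  "set (map set (subseqs [1..<Suc n])) = Pow (X_set n)"
  "distinct (map set (subseqs [1..<Suc n]))"
  by (auto simp: subseqs_powset X_set_def atLeastLessThanSuc_atLeastAtMost distinct_set_subseqs
      simp del: upt_Suc)

lemma minus_one_power_card_sym_diff:
  assumes "finite A" "finite B"
  shows "(-1 :: 'a :: comm_ring_1) ^ card (sym_diff A B) = (-1) ^ card A * (-1) ^ card B"
proof -
  have "card (sym_diff A B) = card (A - B) + card (B - A)"
    using assms by (intro card_Un_disjoint) auto
  moreover have "card A = card (A - B) + card (A \<inter> B)"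
    using assms by (metis card_Diff_subset_Int card_mono finite_Int Int_lower1 le_add_diff_inverse2)
  moreover have "card B = card (B - A) + card (A \<inter> B)"
    using assms by (metis Int_commute card_Diff_subset_Int card_mono finite_Int Int_lower1 le_add_diff_inverse2)
  ultimately show ?thesis
    by (simp add: power_add minus_one_power_iff)
qed

lemma xi_sym_diff_left:
  assumes "finite A" "finite B" "finite C"
  shows "(-1 :: 'a :: comm_ring_1) ^ xi (sym_diff A B) C = (-1) ^ xi A C * (-1) ^ xi B C"
proof -
  have fin: "finite {(a, b) \<in> S \<times> C. a > b}" if "finite S" for S
    by (rule finite_subset[of _ "S \<times> C"]) (use that assms in auto)
  have "{(a, b) \<in> sym_diff A B \<times> C. a > b}
      = sym_diff {(a, b) \<in> A \<times> C. a > b} {(a, b) \<in> B \<times> C. a > b}"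
    by auto
  then show ?thesis
    unfolding xi_def using fin assms by (simp only: minus_one_power_card_sym_diff)
qed

lemma xi_sym_diff_right:
  assumes "finite A" "finite B" "finite C"
  shows "(-1 :: 'a :: comm_ring_1) ^ xi C (sym_diff A B) = (-1) ^ xi C A * (-1) ^ xi C B"
proof -
  have fin: "finite {(a, b) \<in> C \<times> S. a > b}" if "finite S" for S
    by (rule finite_subset[of _ "C \<times> S"]) (use that assms in auto)
  have "{(a, b) \<in> C \<times> sym_diff A B. a > b}
      = sym_diff {(a, b) \<in> C \<times> A. a > b} {(a, b) \<in> C \<times> B. a > b}"
    by auto
  then show ?thesis
    unfolding xi_def using fin assms by (simp only: minus_one_power_card_sym_diff)
qed

lemma group_CL: "group (CL n)"
proof (rule groupI)
  have fin: "finite A" if "A \<subseteq> X_set n" for A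
    using that finite_subset by (auto simp: X_set_def)
  have sgn: "(-1 :: int) ^ k = 1 \<or> (-1 :: int) ^ k = -1" for k
    by (simp add: minus_one_power_iff)
  show "x \<otimes>\<^bsub>CL n\<^esub> y \<in> carrier (CL n)" if "x \<in> carrier (CL n)" "y \<in> carrier (CL n)" for x y
    using that sgn by (fastforce simp: CL_def)
  show "\<one>\<^bsub>CL n\<^esub> \<in> carrier (CL n)"
    by (simp add: CL_def)
  show "x \<otimes>\<^bsub>CL n\<^esub> y \<otimes>\<^bsub>CL n\<^esub> z = x \<otimes>\<^bsub>CL n\<^esub> (y \<otimes>\<^bsub>CL n\<^esub> z)"
    if xyz: "x \<in> carrier (CL n)" "y \<in> carrier (CL n)" "z \<in> carrier (CL n)" for x y z
  proof -
    obtain e A f B g C where eq: "x = (e, A)" "y = (f, B)" "z = (g, C)"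
      by (metis surj_pair)
    have "finite A" "finite B" "finite C"
      using xyz fin by (auto simp: eq CL_def)
    moreover have "sym_diff (sym_diff A B) C = sym_diff A (sym_diff B C)"
      by auto
    ultimately show ?thesis
      by (simp add: eq CL_def xi_sym_diff_left xi_sym_diff_right algebra_simps del: Un_iff)
  qed
  show "\<one>\<^bsub>CL n\<^esub> \<otimes>\<^bsub>CL n\<^esub> x = x" if "x \<in> carrier (CL n)" for x
    using that by (auto simp: CL_def xi_def)
  show "\<exists>y\<in>carrier (CL n). y \<otimes>\<^bsub>CL n\<^esub> x = \<one>\<^bsub>CL n\<^esub>" if x: "x \<in> carrier (CL n)" for x
  proof -
    obtain e A where eq: "x = (e, A)"
      by (metis surj_pair)
    have "(e * (-1) ^ xi A A, A) \<in> carrier (CL n)"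
      using x sgn[of "xi A A"] by (auto simp: eq CL_def)
    moreover have "(e * (-1) ^ xi A A, A) \<otimes>\<^bsub>CL n\<^esub> x = \<one>\<^bsub>CL n\<^esub>"
      using x sgn[of "xi A A"] by (auto simp: eq CL_def)
    ultimately show ?thesis
      by blast
  qed
qed

lemma order_CL: "Coset.order (CL n) = 2 ^ (n + 1)"
  by (simp add: Coset.order_def CL_def X_set_def card_cartesian_product card_Pow)

lemma subgroup_CL: "m \<le> n \<Longrightarrow> subgroup (carrier (CL m)) (CL n)"
proof (rule group.group_incl_imp_subgroup[OF group_CL])
  assume "m \<le> n"
  then show "carrier (CL m) \<subseteq> carrier (CL n)"
    by (auto simp: CL_def X_set_def)
  show "group (CL n\<lparr>carrier := carrier (CL m)\<rparr>)"
    using group_CL[of m] by (simp add: CL_def)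
qed

lemma representation_chi: "representation (CL n) 1 (chi A)"
proof -
  let ?s = "\<lambda>B. (-1 :: complex) ^ card (A \<inter> B)"
  have sq: "?s B * ?s B = 1" for B
    by (simp add: minus_one_power_iff)
  have mult: "chi A (e, B) * chi A (f, C) = mat 1 1 (\<lambda>_. ?s B * ?s C)" for e f B C
    by (rule eq_matI) (auto simp: chi_def scalar_prod_def)
  have unit: "chi A (e, B) \<in> Units (ring_mat TYPE(complex) 1 ())" for e B
  proof -
    have "chi A (e, B) * chi A (e, B) = 1\<^sub>m 1"
      unfolding mult sq by (rule eq_matI) auto
    moreover have "chi A (e, B) \<in> carrier_mat 1 1"
      by (simp add: chi_def)
    ultimately show ?thesis
      by (auto simp: Units_def ring_mat_simps)
  qed
  have hom: "chi A ((e, B) \<otimes>\<^bsub>CL n\<^esub> (f, C)) = chi A (e, B) * chi A (f, C)"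
    if "B \<subseteq> X_set n" "C \<subseteq> X_set n" for e f B C
  proof -
    have "finite B" "finite C"
      using that finite_subset by (auto simp: X_set_def)
    moreover have "A \<inter> sym_diff B C = sym_diff (A \<inter> B) (A \<inter> C)"
      by auto
    ultimately have "?s (sym_diff B C) = ?s B * ?s C"
      by (simp only: minus_one_power_card_sym_diff finite_Int simp_thms)
    then show ?thesis
      unfolding mult by (simp add: CL_def chi_def del: Un_iff)
  qed
  show ?thesis
    unfolding representation_def
  proof (rule homI)
    show "chi A x \<in> carrier (units_of (ring_mat TYPE(complex) 1 ()))" for x
      using unit by (cases x) (simp add: units_of_carrier)
    show "chi A (x \<otimes>\<^bsub>CL n\<^esub> y) = chi A x \<otimes>\<^bsub>units_of (ring_mat TYPE(complex) 1 ())\<^esub> chi A y"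
      if "x \<in> carrier (CL n)" "y \<in> carrier (CL n)" for x y
      using that hom by (cases x; cases y) (auto simp: units_of_mult ring_mat_simps CL_def)
  qed
qed

end

theory Submission
  imports Defs "Jordan_Normal_Form.Spectral_Radius"
begin

text \<open>
  Part (1) is an identity of signs. The other parts are comparisons of characters. The character of
  \<open>\<rho>\<^sub>n\<close> is supported on \<open>\<plusminus>\<gamma>\<^sub>\<emptyset>\<close>, and those of \<open>\<rho>\<^sub>n\<^sup>+\<close> and \<open>\<rho>\<^sub>n\<^sup>-\<close> also see the top
  element \<open>\<gamma>\<^bsub>X\<^esub>\<close> of \<open>CL n\<close>, where they are opposite. So in (2) the two values at the top element
  of \<open>CL (n - 1)\<close> cancel, and in (3) and (5) the top element of \<open>CL n\<close> is lost on restriction. In (4)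
  and (5) both characters vanish away from \<open>\<plusminus>\<gamma>\<^sub>\<emptyset>\<close>, that of the sum because \<open>\<Sum>\<^sub>C (-1)\<^bsup>|C \<inter> B|\<^esup> = 0\<close> for
  \<open>B \<noteq> \<emptyset>\<close> (\<open>sum_sign_Pow\<close>).

  What turns equal characters into one base change for the whole group is
  \<open>multiplicity_free_decomposition\<close>: a representation of a finite group whose character is a sum of
  pairwise different irreducible characters is equivalent to the direct sum of those irreducibles.
  Averaging over the group turns a matrix unit into an intertwiner, and the inner product of two
  characters is a sum of entries of such averages; together with Schur's lemma this gives the orthogonality
  relations and, for every constituent \<open>\<sigma>\<close> of \<open>\<tau>\<close>, intertwiners \<open>T\<close> into \<open>\<tau>\<close> and \<open>S\<close> out of \<open>\<tau>\<close> with \<open>S T = 1\<close>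
  (\<open>intertwiner_split\<close>). For different constituents \<open>S T\<close> vanishes by Schur's lemma, so the block
  row of all \<open>T\<close> has the block column of all \<open>S\<close> as a left inverse (\<open>assemble_constituents\<close>).
  Comparing characters at the identity shows that these matrices are square, and then they are
  the base change.

  In (4) every constituent occurs twice, so this theorem does not apply to the subgroup. But over
  \<open>CL n\<close> itself \<open>\<rho> \<otimes> \<rho>\<close> is the multiplicity-free sum of all \<open>\<chi>\<^sub>C\<close>, \<open>C \<subseteq> X\<^sub>n\<close>, and
  \<open>\<chi>\<^sub>C\<close> and \<open>\<chi>\<^bsub>C \<union> {n}\<^esub>\<close> agree on \<open>CL (n - 1)\<close>.
\<close>

section \<open>Traces, matrix units and sums of matrices\<close>

lemma mat_trace_mult_comm:
  assumes "M \<in> carrier_mat a b" "N \<in> carrier_mat b a"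
  shows "mat_trace (M * N) = mat_trace (N * M)"
proof -
  have "mat_trace (M * N) = (\<Sum>i<a. \<Sum>j<b. M $$ (i, j) * N $$ (j, i))"
    using assms by (auto simp: mat_trace_def scalar_prod_def atLeast0LessThan intro!: sum.cong)
  also have "\<dots> = (\<Sum>j<b. \<Sum>i<a. N $$ (j, i) * M $$ (i, j))"
    by (subst sum.swap) (simp add: mult.commute)
  also have "\<dots> = mat_trace (N * M)"
    using assms by (auto simp: mat_trace_def scalar_prod_def atLeast0LessThan intro!: sum.cong)
  finally show ?thesis .
qed

lemma mat_trace_smult_one: "mat_trace (c \<cdot>\<^sub>m 1\<^sub>m d) = c * of_nat d"
  by (simp add: mat_trace_def)

definition matrix_unit :: "nat \<Rightarrow> nat \<Rightarrow> nat \<Rightarrow> nat \<Rightarrow> complex mat" where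
  "matrix_unit e d a b = mat e d (\<lambda>(i, j). if i = a \<and> j = b then 1 else 0)"

lemma matrix_unit_carrier [simp]: "matrix_unit e d a b \<in> carrier_mat e d"
  by (simp add: matrix_unit_def)

text \<open>Products of this shape are the summands of an average. Their \<open>(a, b)\<close> entry is a product of a
  diagonal entry of \<open>M\<close> and one of \<open>N\<close>, and these add up to a product of traces.\<close>
lemma sandwich_matrix_unit:
  assumes "M \<in> carrier_mat k e" "N \<in> carrier_mat d l" "a < e" "b < d" "i < k" "j < l"
  shows "(M * matrix_unit e d a b * N) $$ (i, j) = M $$ (i, a) * N $$ (b, j)"
proof -
  have "(M * matrix_unit e d a b) $$ (i, r) = (if r = b then M $$ (i, a) else 0)" if "r < d" for r
  proof -
    have "(M * matrix_unit e d a b) $$ (i, r)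
        = (\<Sum>s<e. M $$ (i, s) * (if s = a \<and> r = b then 1 else 0))"
      using assms that by (simp add: scalar_prod_def matrix_unit_def atLeast0LessThan)
    also have "\<dots> = (\<Sum>s<e. if s = a then if r = b then M $$ (i, a) else 0 else 0)"
      by (rule sum.cong) auto
    finally show ?thesis
      using assms by simp
  qed
  then have "(M * matrix_unit e d a b * N) $$ (i, j)
      = (\<Sum>r<d. (if r = b then M $$ (i, a) else 0) * N $$ (r, j))"
    using assms by (simp add: scalar_prod_def matrix_unit_def atLeast0LessThan)
  also have "\<dots> = (\<Sum>r<d. if r = b then M $$ (i, a) * N $$ (b, j) else 0)"
    by (rule sum.cong) auto
  finally show ?thesis
    using assms by simp
qed

lemma mat_trace_matrix_unit_mult:
  assumes "N \<in> carrier_mat d e" "a < e" "b < d"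
  shows "mat_trace (matrix_unit e d a b * N) = N $$ (b, a)"
proof -
  have "mat_trace (matrix_unit e d a b * N) = (\<Sum>i<e. (1\<^sub>m e * matrix_unit e d a b * N) $$ (i, i))"
    using assms by (simp add: mat_trace_def matrix_unit_def)
  also have "\<dots> = (\<Sum>i<e. (if i = a then N $$ (b, a) else 0))"
  proof (intro sum.cong refl)
    fix i assume "i \<in> {..<e}"
    then have "(1\<^sub>m e * matrix_unit e d a b * N) $$ (i, i) = 1\<^sub>m e $$ (i, a) * N $$ (b, i)"
      using assms by (intro sandwich_matrix_unit[of _ e]) auto
    then show "(1\<^sub>m e * matrix_unit e d a b * N) $$ (i, i) = (if i = a then N $$ (b, a) else 0)"
      using assms \<open>i \<in> {..<e}\<close> by simp
  qed
  finally show ?thesis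
    using assms by simp
qed

text \<open>Matrices of all sizes form a single type, which is not an additive monoid, so the big sum operator
  does not apply and the size has to be given.\<close>
definition matrix_sum :: "nat \<Rightarrow> nat \<Rightarrow> ('i \<Rightarrow> complex mat) \<Rightarrow> 'i set \<Rightarrow> complex mat" where
  "matrix_sum e d F I = mat e d (\<lambda>ij. \<Sum>i\<in>I. F i $$ ij)"

lemma matrix_sum_carrier [simp]: "matrix_sum e d F I \<in> carrier_mat e d"
  by (simp add: matrix_sum_def)

lemma matrix_sum_cong:
  "(\<And>i. i \<in> I \<Longrightarrow> F i = F' i) \<Longrightarrow> matrix_sum e d F I = matrix_sum e d F' I"
  unfolding matrix_sum_def by (intro cong_mat refl sum.cong) auto

lemma matrix_sum_reindex:
  "bij_betw h I J \<Longrightarrow> matrix_sum e d (\<lambda>i. F (h i)) I = matrix_sum e d F J"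
  unfolding matrix_sum_def by (intro cong_mat refl sum.reindex_bij_betw)

lemma mult_matrix_sum:
  assumes "M \<in> carrier_mat k e" "\<And>i. i \<in> I \<Longrightarrow> F i \<in> carrier_mat e d"
  shows "M * matrix_sum e d F I = matrix_sum k d (\<lambda>i. M * F i) I"
proof (rule eq_matI)
  fix r c assume "r < dim_row (matrix_sum k d (\<lambda>i. M * F i) I)"
    "c < dim_col (matrix_sum k d (\<lambda>i. M * F i) I)"
  then have rc: "r < k" "c < d"
    by (simp_all add: matrix_sum_def)
  have "(M * matrix_sum e d F I) $$ (r, c) = (\<Sum>s<e. \<Sum>i\<in>I. M $$ (r, s) * F i $$ (s, c))"
    using assms rc by (simp add: matrix_sum_def scalar_prod_def atLeast0LessThan sum_distrib_left)
  also have "\<dots> = (\<Sum>i\<in>I. \<Sum>s<e. M $$ (r, s) * F i $$ (s, c))"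
    by (rule sum.swap)
  also have "\<dots> = (\<Sum>i\<in>I. (M * F i) $$ (r, c))"
    using assms(1) rc by (intro sum.cong refl) (auto simp: scalar_prod_def atLeast0LessThan dest: assms(2))
  finally show "(M * matrix_sum e d F I) $$ (r, c) = matrix_sum k d (\<lambda>i. M * F i) I $$ (r, c)"
    using rc by (simp add: matrix_sum_def)
qed (use assms in \<open>auto simp: matrix_sum_def\<close>)

lemma matrix_sum_mult:
  assumes "M \<in> carrier_mat d k" "\<And>i. i \<in> I \<Longrightarrow> F i \<in> carrier_mat e d"
  shows "matrix_sum e d F I * M = matrix_sum e k (\<lambda>i. F i * M) I"
proof (rule eq_matI)
  fix r c assume "r < dim_row (matrix_sum e k (\<lambda>i. F i * M) I)"
    "c < dim_col (matrix_sum e k (\<lambda>i. F i * M) I)"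
  then have rc: "r < e" "c < k"
    by (simp_all add: matrix_sum_def)
  have "(matrix_sum e d F I * M) $$ (r, c) = (\<Sum>s<d. \<Sum>i\<in>I. F i $$ (r, s) * M $$ (s, c))"
    using assms rc by (simp add: matrix_sum_def scalar_prod_def atLeast0LessThan sum_distrib_right)
  also have "\<dots> = (\<Sum>i\<in>I. \<Sum>s<d. F i $$ (r, s) * M $$ (s, c))"
    by (rule sum.swap)
  also have "\<dots> = (\<Sum>i\<in>I. (F i * M) $$ (r, c))"
    using assms(1) rc by (intro sum.cong refl) (auto simp: scalar_prod_def atLeast0LessThan dest: assms(2))
  finally show "(matrix_sum e d F I * M) $$ (r, c) = matrix_sum e k (\<lambda>i. F i * M) I $$ (r, c)"
    using rc by (simp add: matrix_sum_def)
qed (use assms in \<open>auto simp: matrix_sum_def\<close>)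

lemma mat_trace_matrix_sum:
  assumes "\<And>i. i \<in> I \<Longrightarrow> F i \<in> carrier_mat d d"
  shows "mat_trace (matrix_sum d d F I) = (\<Sum>i\<in>I. mat_trace (F i))"
proof -
  have "mat_trace (matrix_sum d d F I) = (\<Sum>i\<in>I. \<Sum>r<d. F i $$ (r, r))"
    unfolding mat_trace_def matrix_sum_def by (simp add: sum.swap[of _ I])
  also have "\<dots> = (\<Sum>i\<in>I. mat_trace (F i))"
    by (intro sum.cong refl) (auto simp: mat_trace_def dest: assms)
  finally show ?thesis .
qed

section \<open>Representations and intertwiners of a finite group\<close>

locale finite_group = group G for G (structure) +
  assumes finite_carrier: "finite (carrier G)"
begin

lemma
  assumes "representation G d \<rho>"
  shows rep_carrier: "g \<in> carrier G \<Longrightarrow> \<rho> g \<in> carrier_mat d d"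
    and rep_mult: "g \<in> carrier G \<Longrightarrow> h \<in> carrier G \<Longrightarrow> \<rho> (g \<otimes> h) = \<rho> g * \<rho> h"
    and rep_one: "\<rho> \<one> = 1\<^sub>m d"
proof -
  let ?R = "ring_mat TYPE(complex) d ()"
  interpret R: ring ?R
    by (rule ring_mat)
  have hom: "\<rho> \<in> hom G (units_of ?R)"
    using assms by (simp add: representation_def)
  show "\<rho> g \<in> carrier_mat d d" if "g \<in> carrier G"
    using hom_in_carrier[OF hom that] by (simp add: units_of_carrier Units_def ring_mat_simps)
  show "\<rho> (g \<otimes> h) = \<rho> g * \<rho> h" if "g \<in> carrier G" "h \<in> carrier G"
    using hom_mult[OF hom that] by (simp add: units_of_mult ring_mat_simps)
  have "group_hom G (units_of ?R) \<rho>"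
    using hom R.units_group is_group by (simp add: group_hom_def group_hom_axioms_def)
  from group_hom.hom_one[OF this] show "\<rho> \<one> = 1\<^sub>m d"
    by (simp add: units_of_one ring_mat_simps)
qed

lemma representationI:
  assumes "\<And>g. g \<in> carrier G \<Longrightarrow> \<rho> g \<in> carrier_mat d d"
    and "\<And>g h. g \<in> carrier G \<Longrightarrow> h \<in> carrier G \<Longrightarrow> \<rho> (g \<otimes> h) = \<rho> g * \<rho> h"
    and "\<rho> \<one> = 1\<^sub>m d"
  shows "representation G d \<rho>"
  unfolding representation_def
proof (rule homI)
  fix g assume g: "g \<in> carrier G"
  have "\<rho> g * \<rho> (inv g) = 1\<^sub>m d" "\<rho> (inv g) * \<rho> g = 1\<^sub>m d"
    using g assms(2)[of g "inv g"] assms(2)[of "inv g" g] assms(3) by simp_all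
  then show "\<rho> g \<in> carrier (units_of (ring_mat TYPE(complex) d ()))"
    using g assms(1)[of g] assms(1)[of "inv g"]
    by (auto simp: units_of_carrier Units_def ring_mat_simps)
qed (use assms in \<open>auto simp: units_of_mult ring_mat_simps\<close>)

definition intertwiner ::
    "nat \<Rightarrow> nat \<Rightarrow> ('a \<Rightarrow> complex mat) \<Rightarrow> ('a \<Rightarrow> complex mat) \<Rightarrow> complex mat \<Rightarrow> bool" where
  "intertwiner d e \<sigma> \<tau> T \<longleftrightarrow> T \<in> carrier_mat e d \<and> (\<forall>g\<in>carrier G. \<tau> g * T = T * \<sigma> g)"

lemma intertwiner_comp:
  assumes "representation G a \<rho>" "representation G b \<sigma>" "representation G c \<tau>"
    and "intertwiner a b \<rho> \<sigma> T" "intertwiner b c \<sigma> \<tau> S"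
  shows "intertwiner a c \<rho> \<tau> (S * T)"
  unfolding intertwiner_def
proof (intro conjI ballI)
  have T: "T \<in> carrier_mat b a" and S: "S \<in> carrier_mat c b"
    using assms by (auto simp: intertwiner_def)
  then show "S * T \<in> carrier_mat c a"
    by simp
  fix g assume g: "g \<in> carrier G"
  note c = rep_carrier[OF assms(1) g] rep_carrier[OF assms(2) g] rep_carrier[OF assms(3) g]
  have "\<tau> g * (S * T) = (\<tau> g * S) * T"
    using c S T by (simp add: assoc_mult_mat[of _ c c _ b _ a])
  also have "\<dots> = (S * \<sigma> g) * T"
    using assms g by (simp add: intertwiner_def)
  also have "\<dots> = S * (\<sigma> g * T)"
    using c S T by (simp add: assoc_mult_mat[of _ c b _ b _ a])
  also have "\<dots> = S * (T * \<rho> g)"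
    using assms g by (simp add: intertwiner_def)
  also have "\<dots> = S * T * \<rho> g"
    using c S T by (simp add: assoc_mult_mat[of _ c b _ a _ a])
  finally show "\<tau> g * (S * T) = S * T * \<rho> g" .
qed

section \<open>Averaging over the group\<close>

text \<open>Conjugating an arbitrary matrix by \<open>h\<close> and summing over the group is the source of all
  intertwiners below.\<close>
definition average ::
    "nat \<Rightarrow> nat \<Rightarrow> ('a \<Rightarrow> complex mat) \<Rightarrow> ('a \<Rightarrow> complex mat) \<Rightarrow> complex mat \<Rightarrow> complex mat" where
  "average d e \<sigma> \<tau> X = matrix_sum e d (\<lambda>h. \<tau> h * X * \<sigma> (inv h)) (carrier G)"

text \<open>Multiplication by \<open>\<tau> g\<close> from the left permutes the summands, at the price of a factor \<open>\<sigma> g\<close> on the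
  right.\<close>
lemma average_intertwiner:
  assumes \<sigma>: "representation G d \<sigma>" and \<tau>: "representation G e \<tau>" and X: "X \<in> carrier_mat e d"
  shows "intertwiner d e \<sigma> \<tau> (average d e \<sigma> \<tau> X)"
  unfolding intertwiner_def
proof (intro conjI ballI)
  show "average d e \<sigma> \<tau> X \<in> carrier_mat e d"
    by (simp add: average_def)
  fix g assume g: "g \<in> carrier G"
  note [simp] = rep_carrier[OF \<sigma>] rep_carrier[OF \<tau>]
  have summand: "\<tau> h * X * \<sigma> (inv h) \<in> carrier_mat e d" if "h \<in> carrier G" for h
    using that X mult_carrier_mat[of "\<tau> h * X" e d "\<sigma> (inv h)" d] mult_carrier_mat[of "\<tau> h" e e X d]
    by simp
  have shift: "\<tau> g * (\<tau> h * X * \<sigma> (inv h)) = \<tau> (g \<otimes> h) * X * \<sigma> (inv (g \<otimes> h)) * \<sigma> g"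
    if h: "h \<in> carrier G" for h
  proof -
    have "inv h = inv (g \<otimes> h) \<otimes> g"
      using g h by (simp add: inv_mult_group m_assoc)
    then have "\<sigma> (inv h) = \<sigma> (inv (g \<otimes> h)) * \<sigma> g"
      using g h rep_mult[OF \<sigma>, of "inv (g \<otimes> h)" g] by simp
    moreover have "\<tau> (g \<otimes> h) = \<tau> g * \<tau> h"
      using g h by (simp add: rep_mult[OF \<tau>])
    moreover have "\<tau> g * (\<tau> h * X * (U * V)) = \<tau> g * \<tau> h * X * U * V"
      if "U \<in> carrier_mat d d" "V \<in> carrier_mat d d" for U V
    proof -
      have *: "\<tau> h * X \<in> carrier_mat e d" "\<tau> g \<in> carrier_mat e e" "\<tau> h \<in> carrier_mat e e"
        using g h X mult_carrier_mat[of "\<tau> h" e e X d] by simp_all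
      have "\<tau> g * (\<tau> h * X * (U * V)) = \<tau> g * (\<tau> h * X) * (U * V)"
        using * that by (intro assoc_mult_mat[symmetric, of _ e e _ d _ d]) auto
      also have "\<dots> = \<tau> g * (\<tau> h * X) * U * V"
        using * that by (intro assoc_mult_mat[symmetric, of _ e d _ d _ d]) auto
      also have "\<tau> g * (\<tau> h * X) = \<tau> g * \<tau> h * X"
        using * X by (intro assoc_mult_mat[symmetric, of _ e e _ e _ d]) auto
      finally show ?thesis .
    qed
    ultimately show ?thesis
      using g h by simp
  qed
  have "\<tau> g * average d e \<sigma> \<tau> X = matrix_sum e d (\<lambda>h. \<tau> g * (\<tau> h * X * \<sigma> (inv h))) (carrier G)"
    unfolding average_def using g summand by (intro mult_matrix_sum) auto
  also have "\<dots> = matrix_sum e d (\<lambda>h. \<tau> (g \<otimes> h) * X * \<sigma> (inv (g \<otimes> h)) * \<sigma> g) (carrier G)"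
    by (intro matrix_sum_cong shift)
  also have "\<dots> = matrix_sum e d (\<lambda>h. \<tau> h * X * \<sigma> (inv h) * \<sigma> g) (carrier G)"
  proof (rule matrix_sum_reindex)
    show "bij_betw (\<lambda>h. g \<otimes> h) (carrier G) (carrier G)"
      using g by (intro bij_betwI[where g = "\<lambda>h. inv g \<otimes> h"]) (auto simp: m_assoc[symmetric])
  qed
  also have "\<dots> = average d e \<sigma> \<tau> X * \<sigma> g"
    unfolding average_def using g summand by (intro matrix_sum_mult[symmetric]) auto
  finally show "\<tau> g * average d e \<sigma> \<tau> X = average d e \<sigma> \<tau> X * \<sigma> g" .
qed

text \<open>Since \<open>T\<close> can be moved past \<open>\<tau> (inv h)\<close>, averaging commutes with multiplication by an intertwiner.
  This makes the trace of \<open>S T\<close> computable when \<open>S\<close> is an average.\<close>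
lemma average_mult_intertwiner:
  assumes \<sigma>: "representation G d \<sigma>" and \<tau>: "representation G e \<tau>" and Y: "Y \<in> carrier_mat d e"
    and T: "intertwiner d e \<sigma> \<tau> T"
  shows "average e d \<tau> \<sigma> Y * T = average d d \<sigma> \<sigma> (Y * T)"
proof -
  have Tc: "T \<in> carrier_mat e d" and inter: "\<And>g. g \<in> carrier G \<Longrightarrow> \<tau> g * T = T * \<sigma> g"
    using T by (auto simp: intertwiner_def)
  have "average e d \<tau> \<sigma> Y * T = matrix_sum d d (\<lambda>h. \<sigma> h * Y * \<tau> (inv h) * T) (carrier G)"
    unfolding average_def
  proof (rule matrix_sum_mult[OF Tc])
    fix h assume "h \<in> carrier G"
    then show "\<sigma> h * Y * \<tau> (inv h) \<in> carrier_mat d e"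
      using rep_carrier[OF \<sigma>, of h] rep_carrier[OF \<tau>, of "inv h"] Y by simp
  qed
  also have "\<dots> = matrix_sum d d (\<lambda>h. \<sigma> h * (Y * T) * \<sigma> (inv h)) (carrier G)"
  proof (rule matrix_sum_cong)
    fix h assume h: "h \<in> carrier G"
    have c: "\<sigma> h \<in> carrier_mat d d" "\<sigma> (inv h) \<in> carrier_mat d d" "\<tau> (inv h) \<in> carrier_mat e e"
      using h rep_carrier[OF \<sigma>] rep_carrier[OF \<tau>] by auto
    have "\<sigma> h * Y * \<tau> (inv h) * T = \<sigma> h * Y * (\<tau> (inv h) * T)"
      using c Y Tc by (intro assoc_mult_mat[of _ d e _ e _ d]) auto
    also have "\<dots> = \<sigma> h * Y * (T * \<sigma> (inv h))"
      using h inter by simp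
    also have "\<dots> = \<sigma> h * Y * T * \<sigma> (inv h)"
      using c Y Tc by (intro assoc_mult_mat[symmetric, of _ d e _ d _ d]) auto
    also have "\<sigma> h * Y * T = \<sigma> h * (Y * T)"
      using c Y Tc by (intro assoc_mult_mat[of _ d d _ e _ d]) auto
    finally show "\<sigma> h * Y * \<tau> (inv h) * T = \<sigma> h * (Y * T) * \<sigma> (inv h)" .
  qed
  finally show ?thesis
    by (simp add: average_def)
qed

lemma mat_trace_average:
  assumes \<sigma>: "representation G d \<sigma>" and X: "X \<in> carrier_mat d d"
  shows "mat_trace (average d d \<sigma> \<sigma> X) = of_nat (card (carrier G)) * mat_trace X"
proof -
  have "mat_trace (\<sigma> h * X * \<sigma> (inv h)) = mat_trace X" if h: "h \<in> carrier G" for h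
  proof -
    have c: "\<sigma> h \<in> carrier_mat d d" "\<sigma> (inv h) \<in> carrier_mat d d"
      using h rep_carrier[OF \<sigma>] by auto
    have "mat_trace (\<sigma> h * X * \<sigma> (inv h)) = mat_trace (\<sigma> (inv h) * (\<sigma> h * X))"
      using c X by (intro mat_trace_mult_comm[of _ d d]) auto
    also have "\<sigma> (inv h) * (\<sigma> h * X) = \<sigma> (inv h) * \<sigma> h * X"
      using c X by (intro assoc_mult_mat[symmetric, of _ d d _ d _ d]) auto
    also have "\<sigma> (inv h) * \<sigma> h = 1\<^sub>m d"
      using h rep_mult[OF \<sigma>, of "inv h" h] rep_one[OF \<sigma>] by simp
    finally show ?thesis
      using X by simp
  qed
  moreover have "mat_trace (average d d \<sigma> \<sigma> X) = (\<Sum>h\<in>carrier G. mat_trace (\<sigma> h * X * \<sigma> (inv h)))"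
    unfolding average_def
  proof (rule mat_trace_matrix_sum)
    fix h assume "h \<in> carrier G"
    then show "\<sigma> h * X * \<sigma> (inv h) \<in> carrier_mat d d"
      using rep_carrier[OF \<sigma>, of h] rep_carrier[OF \<sigma>, of "inv h"] X by simp
  qed
  ultimately show ?thesis
    by simp
qed

section \<open>Schur's lemma\<close>

lemma subspace_vecI:
  assumes "W \<subseteq> carrier_vec d" "0\<^sub>v d \<in> W"
    and "\<And>v w. v \<in> W \<Longrightarrow> w \<in> W \<Longrightarrow> v + w \<in> W"
    and "\<And>c v. v \<in> W \<Longrightarrow> c \<cdot>\<^sub>v v \<in> W"
  shows "VectorSpace.subspace class_ring W (module_vec TYPE(complex) d)"
proof -
  interpret vec_space "TYPE(complex)" d .
  show ?thesis
    unfolding VectorSpace.subspace_def LinearCombinations.submodule_def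
    using assms vectorspace_axioms module_axioms by (auto simp: module_vec_simps)
qed

text \<open>Over the complex numbers \<open>M\<close> has an eigenvalue, and its eigenspace is invariant because \<open>M\<close> commutes
  with the representation; by irreducibility it is everything.\<close>
lemma schur_scalar:
  assumes \<sigma>: "irreducible_rep G d \<sigma>" and M: "intertwiner d d \<sigma> \<sigma> M"
  obtains c where "M = c \<cdot>\<^sub>m 1\<^sub>m d"
proof -
  have rep: "representation G d \<sigma>" and "d > 0"
    using \<sigma> by (auto simp: irreducible_rep_def)
  have Mc: "M \<in> carrier_mat d d" and comm: "\<And>g. g \<in> carrier G \<Longrightarrow> \<sigma> g * M = M * \<sigma> g"
    using M by (auto simp: intertwiner_def)
  obtain c v where v: "v \<in> carrier_vec d" "v \<noteq> 0\<^sub>v d" "M *\<^sub>v v = c \<cdot>\<^sub>v v"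
    using spectrum_non_empty[OF Mc \<open>d > 0\<close>] Mc
    by (auto simp: spectrum_def eigenvalue_def eigenvector_def)
  define W where "W = {v \<in> carrier_vec d. M *\<^sub>v v = c \<cdot>\<^sub>v v}"
  have "VectorSpace.subspace class_ring W (module_vec TYPE(complex) d)"
  proof (rule subspace_vecI)
    show "0\<^sub>v d \<in> W"
      using Mc by (auto simp: W_def)
    show "x + y \<in> W" if "x \<in> W" "y \<in> W" for x y
      using that Mc by (auto simp: W_def mult_add_distrib_mat_vec[of _ d d] smult_add_distrib_vec[of _ d])
    show "k \<cdot>\<^sub>v x \<in> W" if "x \<in> W" for k x
      using that Mc by (auto simp: W_def mult_mat_vec[of _ d d] smult_smult_assoc mult.commute)
  qed (auto simp: W_def)
  moreover have "\<sigma> g *\<^sub>v w \<in> W" if g: "g \<in> carrier G" and w: "w \<in> W" for g w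
  proof -
    have gc: "\<sigma> g \<in> carrier_mat d d"
      by (rule rep_carrier[OF rep g])
    have wc: "w \<in> carrier_vec d" and "M *\<^sub>v w = c \<cdot>\<^sub>v w"
      using w by (auto simp: W_def)
    have "M *\<^sub>v (\<sigma> g *\<^sub>v w) = (M * \<sigma> g) *\<^sub>v w"
      using Mc gc wc by (intro assoc_mult_mat_vec[symmetric]) auto
    also have "\<dots> = (\<sigma> g * M) *\<^sub>v w"
      using comm[OF g] by simp
    also have "\<dots> = \<sigma> g *\<^sub>v (M *\<^sub>v w)"
      using Mc gc wc by (intro assoc_mult_mat_vec) auto
    also have "\<dots> = c \<cdot>\<^sub>v (\<sigma> g *\<^sub>v w)"
      using gc wc \<open>M *\<^sub>v w = c \<cdot>\<^sub>v w\<close> by (simp add: mult_mat_vec[of _ d d])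
    finally show ?thesis
      using gc wc by (auto simp: W_def)
  qed
  moreover have "W \<noteq> {0\<^sub>v d}"
    using v by (auto simp: W_def)
  ultimately have all: "W = carrier_vec d"
    using \<sigma> unfolding irreducible_rep_def by blast
  have "M = c \<cdot>\<^sub>m 1\<^sub>m d"
  proof (rule eq_matI)
    fix i j assume "i < dim_row (c \<cdot>\<^sub>m 1\<^sub>m d)" "j < dim_col (c \<cdot>\<^sub>m 1\<^sub>m d)"
    then have ij: "i < d" "j < d"
      by auto
    have "unit_vec d j \<in> W"
      by (simp add: all)
    then have "(M *\<^sub>v unit_vec d j) $ i = (c \<cdot>\<^sub>v unit_vec d j) $ i"
      by (simp add: W_def)
    moreover have "(M *\<^sub>v unit_vec d j) $ i = M $$ (i, j)"
      using ij Mc by simp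
    ultimately show "M $$ (i, j) = (c \<cdot>\<^sub>m 1\<^sub>m d) $$ (i, j)"
      using ij by simp
  qed (use Mc in auto)
  then show thesis
    by (rule that)
qed

lemma intertwiner_smult:
  assumes "representation G d \<sigma>" "representation G e \<tau>" "intertwiner d e \<sigma> \<tau> T"
  shows "intertwiner d e \<sigma> \<tau> (c \<cdot>\<^sub>m T)"
  unfolding intertwiner_def
proof (intro conjI ballI)
  show "c \<cdot>\<^sub>m T \<in> carrier_mat e d"
    using assms by (auto simp: intertwiner_def)
  fix g assume g: "g \<in> carrier G"
  show "\<tau> g * (c \<cdot>\<^sub>m T) = c \<cdot>\<^sub>m T * \<sigma> g"
    using assms g rep_carrier[OF assms(1) g] rep_carrier[OF assms(2) g]
    by (auto simp: intertwiner_def mult_smult_distrib[of _ e e _ d] mult_smult_assoc_mat[of _ e d _ d])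
qed

text \<open>The retraction is the average of the matrix unit dual to a nonzero entry of \<open>T\<close>, rescaled: \<open>S T\<close> is a
  scalar by Schur's lemma, and its trace is \<open>|G|\<close> times that entry, hence the scalar is not zero.\<close>
lemma intertwiner_split:
  assumes \<sigma>: "irreducible_rep G d \<sigma>" and \<tau>: "representation G e \<tau>"
    and T: "intertwiner d e \<sigma> \<tau> T" "T \<noteq> 0\<^sub>m e d"
  obtains S where "intertwiner e d \<tau> \<sigma> S" "S * T = 1\<^sub>m d"
proof -
  have rep: "representation G d \<sigma>" and d: "d > 0"
    using \<sigma> by (auto simp: irreducible_rep_def)
  have Tc: "T \<in> carrier_mat e d"
    using T by (simp add: intertwiner_def)
  obtain a b where ab: "a < e" "b < d" "T $$ (a, b) \<noteq> 0"
  proof -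
    have "T = 0\<^sub>m e d" if "\<And>a b. a < e \<Longrightarrow> b < d \<Longrightarrow> T $$ (a, b) = 0"
      using that Tc by (intro eq_matI) auto
    with T(2) that show thesis
      by blast
  qed
  define S where "S = average e d \<tau> \<sigma> (matrix_unit d e b a)"
  have S: "intertwiner e d \<tau> \<sigma> S"
    unfolding S_def by (intro average_intertwiner rep \<tau>) simp
  then have Sc: "S \<in> carrier_mat d e"
    by (simp add: intertwiner_def)
  have "intertwiner d d \<sigma> \<sigma> (S * T)"
    by (rule intertwiner_comp[OF rep \<tau> rep T(1) S])
  then obtain c where c: "S * T = c \<cdot>\<^sub>m 1\<^sub>m d"
    using schur_scalar[OF \<sigma>] by metis
  have "mat_trace (S * T) = of_nat (card (carrier G)) * mat_trace (matrix_unit d e b a * T)"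
    unfolding S_def using Tc
    by (simp add: average_mult_intertwiner[OF rep \<tau> _ T(1)] mat_trace_average[OF rep]
        mult_carrier_mat[of _ d e _ d])
  also have "\<dots> = of_nat (card (carrier G)) * T $$ (a, b)"
    using ab by (simp add: mat_trace_matrix_unit_mult[OF Tc])
  also have "\<dots> \<noteq> 0"
    using ab finite_carrier one_closed by auto
  finally have "c \<noteq> 0"
    unfolding c by (auto simp: mat_trace_smult_one)
  have "intertwiner e d \<tau> \<sigma> (inverse c \<cdot>\<^sub>m S)"
    by (rule intertwiner_smult[OF \<tau> rep S])
  moreover have "(inverse c \<cdot>\<^sub>m S) * T = 1\<^sub>m d"
    using \<open>c \<noteq> 0\<close> Sc Tc by (auto simp: mult_smult_assoc_mat[of _ d e _ d] c)
  ultimately show thesis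
    by (rule that)
qed

text \<open>For irreducible representations this is inequivalence; in the applications it is read off from the
  characters.\<close>
definition characters_differ :: "('a \<Rightarrow> complex mat) \<Rightarrow> ('a \<Rightarrow> complex mat) \<Rightarrow> bool" where
  "characters_differ \<sigma> \<tau> \<longleftrightarrow> (\<exists>g\<in>carrier G. character \<sigma> g \<noteq> character \<tau> g)"

lemma characters_differ_sym: "characters_differ \<sigma> \<tau> \<Longrightarrow> characters_differ \<tau> \<sigma>"
  unfolding characters_differ_def by metis

text \<open>A nonzero \<open>M\<close> has a left inverse intertwiner \<open>N\<close>. By Schur's lemma on the other side \<open>M N\<close> is a
  scalar, and \<open>M N M = M\<close> forces it to be \<open>1\<close>. So \<open>M\<close> is invertible and the characters agree.\<close>
lemma schur_zero:
  assumes \<sigma>: "irreducible_rep G d \<sigma>" and \<tau>: "irreducible_rep G e \<tau>"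
    and M: "intertwiner d e \<sigma> \<tau> M" and ineq: "characters_differ \<sigma> \<tau>"
  shows "M = 0\<^sub>m e d"
proof (rule ccontr)
  obtain g where g: "g \<in> carrier G" "character \<sigma> g \<noteq> character \<tau> g"
    using ineq unfolding characters_differ_def ..
  assume "M \<noteq> 0\<^sub>m e d"
  have reps: "representation G d \<sigma>" "representation G e \<tau>" and d: "d > 0"
    using \<sigma> \<tau> by (auto simp: irreducible_rep_def)
  obtain N where N: "intertwiner e d \<tau> \<sigma> N" "N * M = 1\<^sub>m d"
    using intertwiner_split[OF \<sigma> reps(2) M \<open>M \<noteq> _\<close>] .
  have Mc: "M \<in> carrier_mat e d" and Nc: "N \<in> carrier_mat d e"
    using M N by (auto simp: intertwiner_def)
  obtain c where c: "M * N = c \<cdot>\<^sub>m 1\<^sub>m e"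
    using schur_scalar[OF \<tau> intertwiner_comp[OF reps(2) reps(1) reps(2) N(1) M]] .
  have "M = M * (N * M)"
    using Mc N by simp
  also have "\<dots> = M * N * M"
    using Mc Nc by (intro assoc_mult_mat[symmetric]) auto
  also have "\<dots> = c \<cdot>\<^sub>m M"
    using Mc by (simp add: c mult_smult_assoc_mat[of _ e e _ d])
  finally have cM: "c \<cdot>\<^sub>m M = M"
    by simp
  have "c = 1"
  proof (rule ccontr)
    assume "c \<noteq> 1"
    have "M = 0\<^sub>m e d"
    proof (rule eq_matI)
      fix i j assume "i < dim_row (0\<^sub>m e d :: complex mat)" "j < dim_col (0\<^sub>m e d :: complex mat)"
      then have "i < e" "j < d" "(c \<cdot>\<^sub>m M) $$ (i, j) = M $$ (i, j)"
        by (simp_all add: cM)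
      then show "M $$ (i, j) = 0\<^sub>m e d $$ (i, j)"
        using Mc \<open>c \<noteq> 1\<close> by simp
    qed (use Mc in auto)
    with \<open>M \<noteq> _\<close> show False ..
  qed
  have \<sigma>g: "\<sigma> g \<in> carrier_mat d d" and \<tau>g: "\<tau> g \<in> carrier_mat e e"
    using rep_carrier reps g by auto
  have one_smult: "1 \<cdot>\<^sub>m 1\<^sub>m e = (1\<^sub>m e :: complex mat)"
    by (rule eq_matI) auto
  have "mat_trace (\<tau> g) = mat_trace (\<tau> g * (M * N))"
    using \<tau>g one_smult by (simp add: c \<open>c = 1\<close>)
  also have "\<tau> g * (M * N) = \<tau> g * M * N"
    using \<tau>g Mc Nc by (intro assoc_mult_mat[symmetric]) auto
  also have "\<dots> = M * \<sigma> g * N"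
    using M g by (simp add: intertwiner_def)
  also have "mat_trace \<dots> = mat_trace (N * (M * \<sigma> g))"
    using Mc Nc \<sigma>g by (intro mat_trace_mult_comm[of _ e d]) auto
  also have "N * (M * \<sigma> g) = N * M * \<sigma> g"
    using Mc Nc \<sigma>g by (intro assoc_mult_mat[symmetric]) auto
  finally show False
    using g(2) \<sigma>g by (simp add: N(2) character_def)
qed

section \<open>Orthogonality of irreducible characters\<close>

text \<open>For a character \<open>\<psi>\<close> this is \<open>|G|\<close> times the usual inner product: \<open>\<psi> (inv h)\<close> is the complex
  conjugate of \<open>\<psi> h\<close>.\<close>
definition char_prod :: "('a \<Rightarrow> complex) \<Rightarrow> ('a \<Rightarrow> complex) \<Rightarrow> complex" where
  "char_prod \<phi> \<psi> = (\<Sum>h\<in>carrier G. \<phi> h * \<psi> (inv h))"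

text \<open>This identity converts information about intertwiners into information about characters: it yields
  the orthogonality relations and, read backwards, the existence of nonzero intertwiners.\<close>
lemma char_prod_average:
  assumes \<sigma>: "representation G d \<sigma>" and \<tau>: "representation G e \<tau>"
  shows "char_prod (character \<tau>) (character \<sigma>)
       = (\<Sum>a<e. \<Sum>b<d. average d e \<sigma> \<tau> (matrix_unit e d a b) $$ (a, b))"
proof -
  have "char_prod (character \<tau>) (character \<sigma>)
      = (\<Sum>h\<in>carrier G. \<Sum>a<e. \<Sum>b<d. (\<tau> h * matrix_unit e d a b * \<sigma> (inv h)) $$ (a, b))"
    unfolding char_prod_def
  proof (rule sum.cong[OF refl])
    fix h assume h: "h \<in> carrier G"
    have c: "\<tau> h \<in> carrier_mat e e" "\<sigma> (inv h) \<in> carrier_mat d d"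
      using rep_carrier[OF \<tau>] rep_carrier[OF \<sigma>] h by auto
    have "character \<tau> h * character \<sigma> (inv h)
        = (\<Sum>a<e. \<Sum>b<d. \<tau> h $$ (a, a) * \<sigma> (inv h) $$ (b, b))"
      using c by (simp add: character_def mat_trace_def sum_product)
    also have "\<dots> = (\<Sum>a<e. \<Sum>b<d. (\<tau> h * matrix_unit e d a b * \<sigma> (inv h)) $$ (a, b))"
      by (intro sum.cong refl sandwich_matrix_unit[OF c, symmetric]) auto
    finally show "character \<tau> h * character \<sigma> (inv h)
        = (\<Sum>a<e. \<Sum>b<d. (\<tau> h * matrix_unit e d a b * \<sigma> (inv h)) $$ (a, b))" .
  qed
  also have "\<dots> = (\<Sum>a<e. \<Sum>h\<in>carrier G. \<Sum>b<d. (\<tau> h * matrix_unit e d a b * \<sigma> (inv h)) $$ (a, b))"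
    by (rule sum.swap)
  also have "\<dots> = (\<Sum>a<e. \<Sum>b<d. \<Sum>h\<in>carrier G. (\<tau> h * matrix_unit e d a b * \<sigma> (inv h)) $$ (a, b))"
    by (intro sum.cong refl sum.swap)
  also have "\<dots> = (\<Sum>a<e. \<Sum>b<d. average d e \<sigma> \<tau> (matrix_unit e d a b) $$ (a, b))"
    by (simp add: average_def matrix_sum_def)
  finally show ?thesis .
qed

text \<open>The average of the matrix unit at \<open>(a, b)\<close> is a scalar by Schur's lemma, and comparing traces its
  value is \<open>|G| / d\<close> for \<open>a = b\<close> and \<open>0\<close> otherwise; only the \<open>d\<close> diagonal terms contribute.\<close>
lemma char_prod_self:
  assumes \<sigma>: "irreducible_rep G d \<sigma>"
  shows "char_prod (character \<sigma>) (character \<sigma>) = of_nat (card (carrier G))"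
proof -
  have rep: "representation G d \<sigma>" and d: "d > 0"
    using \<sigma> by (auto simp: irreducible_rep_def)
  have "average d d \<sigma> \<sigma> (matrix_unit d d a b) $$ (a, b)
      = (if a = b then of_nat (card (carrier G)) / of_nat d else 0)" if ab: "a < d" "b < d" for a b
  proof -
    obtain c where c: "average d d \<sigma> \<sigma> (matrix_unit d d a b) = c \<cdot>\<^sub>m 1\<^sub>m d"
      using schur_scalar[OF \<sigma> average_intertwiner[OF rep rep matrix_unit_carrier]] .
    have "mat_trace (matrix_unit d d a b) = mat_trace (matrix_unit d d a b * 1\<^sub>m d)"
      by (simp only: right_mult_one_mat[OF matrix_unit_carrier])
    also have "\<dots> = (if a = b then 1 else 0)"
      using ab by (subst mat_trace_matrix_unit_mult) auto
    finally have "c * of_nat d = (if a = b then of_nat (card (carrier G)) else 0)"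
      using mat_trace_average[OF rep matrix_unit_carrier, of a b] by (simp add: c mat_trace_smult_one)
    then show ?thesis
      using d ab by (auto simp: c field_simps)
  qed
  then have "char_prod (character \<sigma>) (character \<sigma>)
      = (\<Sum>a<d. \<Sum>b<d. if a = b then of_nat (card (carrier G)) / of_nat d else 0)"
    unfolding char_prod_average[OF rep rep] by (intro sum.cong refl) auto
  then show ?thesis
    using d by simp
qed

lemma char_prod_characters_differ:
  assumes \<sigma>: "irreducible_rep G d \<sigma>" and \<tau>: "irreducible_rep G e \<tau>" and "characters_differ \<sigma> \<tau>"
  shows "char_prod (character \<tau>) (character \<sigma>) = 0"
proof -
  have rep: "representation G d \<sigma>" "representation G e \<tau>"
    using \<sigma> \<tau> by (auto simp: irreducible_rep_def)
  have "average d e \<sigma> \<tau> (matrix_unit e d a b) = 0\<^sub>m e d" for a b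
    by (intro schur_zero[OF \<sigma> \<tau> _ assms(3)] average_intertwiner rep) simp
  then show ?thesis
    unfolding char_prod_average[OF rep] by simp
qed

lemma char_prod_sum_list:
  "char_prod (\<lambda>g. \<Sum>\<tau>\<leftarrow>\<tau>s. \<phi> \<tau> g) \<psi> = (\<Sum>\<tau>\<leftarrow>\<tau>s. char_prod (\<phi> \<tau>) \<psi>)"
  by (induction \<tau>s) (simp_all add: char_prod_def algebra_simps sum.distrib)

lemma char_prod_constituent:
  assumes "\<And>\<sigma>. \<sigma> \<in> set \<sigma>s \<Longrightarrow> \<exists>d. irreducible_rep G d \<sigma>" "sorted_wrt characters_differ \<sigma>s"
    and "\<sigma> \<in> set \<sigma>s"
  shows "char_prod (\<lambda>g. \<Sum>\<sigma>\<leftarrow>\<sigma>s. character \<sigma> g) (character \<sigma>) = of_nat (card (carrier G))"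
proof -
  have zero: "(\<Sum>\<tau>\<leftarrow>\<tau>s. char_prod (character \<tau>) (character \<sigma>)) = 0"
    if "\<And>\<tau>. \<tau> \<in> set \<tau>s \<Longrightarrow> \<exists>d. irreducible_rep G d \<tau>" "\<And>\<tau>. \<tau> \<in> set \<tau>s \<Longrightarrow> characters_differ \<sigma> \<tau>"
      "irreducible_rep G d \<sigma>" for \<tau>s \<sigma> d
    using that
  proof (induction \<tau>s)
    case (Cons \<tau> \<tau>s)
    obtain e where "irreducible_rep G e \<tau>"
      using Cons.prems(1)[of \<tau>] by auto
    then have "char_prod (character \<tau>) (character \<sigma>) = 0"
      using Cons.prems by (intro char_prod_characters_differ) auto
    moreover have "(\<Sum>\<tau>\<leftarrow>\<tau>s. char_prod (character \<tau>) (character \<sigma>)) = 0"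
      using Cons.prems by (intro Cons.IH) auto
    ultimately show ?case
      by simp
  qed simp
  have "(\<Sum>\<tau>\<leftarrow>\<sigma>s. char_prod (character \<tau>) (character \<sigma>)) = of_nat (card (carrier G))"
    using assms
  proof (induction \<sigma>s)
    case (Cons \<tau> \<tau>s)
    obtain e where e: "irreducible_rep G e \<tau>"
      using Cons.prems(1)[of \<tau>] by auto
    show ?case
    proof (cases "\<sigma> = \<tau>")
      case True
      then have "(\<Sum>\<tau>\<leftarrow>\<tau>s. char_prod (character \<tau>) (character \<sigma>)) = 0"
        using Cons.prems e by (intro zero[of _ _ e]) auto
      then show ?thesis
        using True char_prod_self[OF e] by simp
    next
      case False
      then have \<sigma>: "\<sigma> \<in> set \<tau>s"
        using Cons.prems by simp
      then obtain d where d: "irreducible_rep G d \<sigma>"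
        using Cons.prems(1)[of \<sigma>] by auto
      have "char_prod (character \<tau>) (character \<sigma>) = 0"
        using Cons.prems \<sigma> by (intro char_prod_characters_differ[OF d e] characters_differ_sym[of \<tau> \<sigma>]) auto
      moreover have "(\<Sum>\<tau>\<leftarrow>\<tau>s. char_prod (character \<tau>) (character \<sigma>)) = of_nat (card (carrier G))"
        by (rule Cons.IH) (use Cons.prems(1,2) \<sigma> in auto)
      ultimately show ?thesis
        by simp
    qed
  qed simp
  then show ?thesis
    by (simp add: char_prod_sum_list)
qed

lemma nonzero_intertwiner:
  assumes \<sigma>: "representation G d \<sigma>" and \<tau>: "representation G e \<tau>"
    and "char_prod (character \<tau>) (character \<sigma>) \<noteq> 0"
  obtains T where "intertwiner d e \<sigma> \<tau> T" "T \<noteq> 0\<^sub>m e d"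
proof -
  have "char_prod (character \<tau>) (character \<sigma>) = 0"
    if "\<And>a b. a < e \<Longrightarrow> b < d \<Longrightarrow> average d e \<sigma> \<tau> (matrix_unit e d a b) $$ (a, b) = 0"
    unfolding char_prod_average[OF \<sigma> \<tau>] using that by (intro sum.neutral ballI) simp
  with assms(3) obtain a b where "a < e" "b < d" "average d e \<sigma> \<tau> (matrix_unit e d a b) $$ (a, b) \<noteq> 0"
    by blast
  then show thesis
    by (intro that[OF average_intertwiner[OF \<sigma> \<tau> matrix_unit_carrier[of e d a b]]]) auto
qed

section \<open>Multiplicity-free representations are determined by their character\<close>

abbreviation rep_dim :: "('a \<Rightarrow> complex mat) \<Rightarrow> nat" where
  "rep_dim \<sigma> \<equiv> dim_row (\<sigma> \<one>)"

lemma rep_dim_eq: "representation G d \<sigma> \<Longrightarrow> rep_dim \<sigma> = d"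
  by (simp add: rep_one)

lemma rep_sum_Nil: "rep_sum [] g = 0\<^sub>m 0 0"
  by (simp add: rep_sum_def)

lemma rep_sum_carrier:
  assumes "\<And>\<sigma>. \<sigma> \<in> set \<sigma>s \<Longrightarrow> \<exists>d. representation G d \<sigma>" "g \<in> carrier G"
  shows "rep_sum \<sigma>s g \<in> carrier_mat (\<Sum>\<sigma>\<leftarrow>\<sigma>s. rep_dim \<sigma>) (\<Sum>\<sigma>\<leftarrow>\<sigma>s. rep_dim \<sigma>)"
proof -
  have dims: "dim_row (\<sigma> g) = rep_dim \<sigma> \<and> dim_col (\<sigma> g) = rep_dim \<sigma>" if "\<sigma> \<in> set \<sigma>s" for \<sigma>
  proof -
    obtain d where "representation G d \<sigma>"
      using assms(1)[OF \<open>\<sigma> \<in> set \<sigma>s\<close>] ..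
    from rep_carrier[OF this assms(2)] rep_dim_eq[OF this] show ?thesis
      by simp
  qed
  have "(\<Sum>\<sigma>\<leftarrow>\<sigma>s. dim_row (\<sigma> g)) = (\<Sum>\<sigma>\<leftarrow>\<sigma>s. rep_dim \<sigma>)"
    by (rule arg_cong[OF map_cong[OF refl dims[THEN conjunct1]]])
  moreover have "(\<Sum>\<sigma>\<leftarrow>\<sigma>s. dim_col (\<sigma> g)) = (\<Sum>\<sigma>\<leftarrow>\<sigma>s. rep_dim \<sigma>)"
    by (rule arg_cong[OF map_cong[OF refl dims[THEN conjunct2]]])
  ultimately show ?thesis
    unfolding carrier_mat_def by (simp only: rep_sum_def dim_diag_block_mat map_map o_def mem_Collect_eq simp_thms)
qed

lemma rep_sum_Cons:
  assumes "\<And>\<sigma>. \<sigma> \<in> set \<sigma>s \<Longrightarrow> \<exists>d. representation G d \<sigma>" "representation G d \<sigma>" "g \<in> carrier G"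
    and "D = (\<Sum>\<sigma>\<leftarrow>\<sigma>s. rep_dim \<sigma>)"
  shows "rep_sum (\<sigma> # \<sigma>s) g = four_block_mat (\<sigma> g) (0\<^sub>m d D) (0\<^sub>m D d) (rep_sum \<sigma>s g)"
proof -
  have "rep_sum \<sigma>s g \<in> carrier_mat D D"
    unfolding assms(4) by (rule rep_sum_carrier[OF assms(1) assms(3)])
  then show ?thesis
    using rep_carrier[OF assms(2,3)] by (simp add: rep_sum_def Let_def)
qed

text \<open>The last two clauses carry the induction: the block row \<open>T\<close> and the block column \<open>S\<close> are orthogonal
  to every irreducible not yet used. When the next constituent is attached, they kill the
  off-diagonal blocks of \<open>S T\<close>.\<close>
lemma assemble_constituents:
  assumes \<tau>: "representation G e \<tau>"
    and "\<And>\<sigma>. \<sigma> \<in> set \<sigma>s \<Longrightarrow> \<exists>d. irreducible_rep G d \<sigma>" "sorted_wrt characters_differ \<sigma>s"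
    and "\<And>\<sigma>. \<sigma> \<in> set \<sigma>s \<Longrightarrow> char_prod (character \<tau>) (character \<sigma>) \<noteq> 0"
    and D: "D = (\<Sum>\<sigma>\<leftarrow>\<sigma>s. rep_dim \<sigma>)"
  shows "\<exists>T S. T \<in> carrier_mat e D \<and> S \<in> carrier_mat D e \<and> S * T = 1\<^sub>m D \<and>
    (\<forall>g\<in>carrier G. \<tau> g * T = T * rep_sum \<sigma>s g) \<and>
    (\<forall>\<rho> d. irreducible_rep G d \<rho> \<and> (\<forall>\<sigma>\<in>set \<sigma>s. characters_differ \<rho> \<sigma>) \<longrightarrow>
       (\<forall>M. intertwiner d e \<rho> \<tau> M \<longrightarrow> S * M = 0\<^sub>m D d) \<and>
       (\<forall>N. intertwiner e d \<tau> \<rho> N \<longrightarrow> N * T = 0\<^sub>m d D))"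
  using assms(2-)
proof (induction \<sigma>s arbitrary: D)
  case Nil
  have "0\<^sub>m 0 e * 0\<^sub>m e 0 = (1\<^sub>m 0 :: complex mat)"
    by (rule eq_matI) auto
  moreover have "\<tau> g * 0\<^sub>m e 0 = 0\<^sub>m e 0 * 0\<^sub>m 0 0" if "g \<in> carrier G" for g
    using rep_carrier[OF \<tau> that] by simp
  moreover have "0\<^sub>m 0 e * M = 0\<^sub>m 0 d \<and> N * 0\<^sub>m e 0 = 0\<^sub>m d 0"
    if "M \<in> carrier_mat e d" "N \<in> carrier_mat d e" for d and M N :: "complex mat"
    using that by simp
  ultimately show ?case
    using Nil by (intro exI[of _ "0\<^sub>m e 0"] exI[of _ "0\<^sub>m 0 e"]) (auto simp: rep_sum_Nil intertwiner_def)
next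
  case (Cons \<sigma> \<sigma>s)
  define D' where "D' = (\<Sum>\<sigma>\<leftarrow>\<sigma>s. rep_dim \<sigma>)"
  obtain d where \<sigma>: "irreducible_rep G d \<sigma>"
    using Cons.prems(1)[of \<sigma>] by auto
  then have rep: "representation G d \<sigma>"
    by (simp add: irreducible_rep_def)
  have D: "D = d + D'"
    using Cons.prems(4) by (simp add: D'_def rep_dim_eq[OF rep])
  have reps: "\<And>\<sigma>. \<sigma> \<in> set \<sigma>s \<Longrightarrow> \<exists>d. representation G d \<sigma>"
    using Cons.prems(1) by (force simp: irreducible_rep_def)
  obtain T' S' where T': "T' \<in> carrier_mat e D'" and S': "S' \<in> carrier_mat D' e" and
    ST': "S' * T' = 1\<^sub>m D'" and
    comm': "\<And>g. g \<in> carrier G \<Longrightarrow> \<tau> g * T' = T' * rep_sum \<sigma>s g" and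
    S'_zero: "\<And>\<rho> d M. irreducible_rep G d \<rho> \<Longrightarrow> \<forall>\<sigma>\<in>set \<sigma>s. characters_differ \<rho> \<sigma> \<Longrightarrow>
      intertwiner d e \<rho> \<tau> M \<Longrightarrow> S' * M = 0\<^sub>m D' d" and
    T'_zero: "\<And>\<rho> d N. irreducible_rep G d \<rho> \<Longrightarrow> \<forall>\<sigma>\<in>set \<sigma>s. characters_differ \<rho> \<sigma> \<Longrightarrow>
      intertwiner e d \<tau> \<rho> N \<Longrightarrow> N * T' = 0\<^sub>m d D'"
    using Cons.IH[OF _ _ _ D'_def] Cons.prems(1-3) by auto
  obtain T1 where T1: "intertwiner d e \<sigma> \<tau> T1" "T1 \<noteq> 0\<^sub>m e d"
    using nonzero_intertwiner[OF rep \<tau>] Cons.prems(3) by auto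
  then have T1c: "T1 \<in> carrier_mat e d"
    by (simp add: intertwiner_def)
  obtain S1 where S1: "intertwiner e d \<tau> \<sigma> S1" "S1 * T1 = 1\<^sub>m d"
    using intertwiner_split[OF \<sigma> \<tau> T1] .
  then have S1c: "S1 \<in> carrier_mat d e"
    by (simp add: intertwiner_def)
  have ineq: "\<forall>\<sigma>'\<in>set \<sigma>s. characters_differ \<sigma> \<sigma>'"
    using Cons.prems(2) by simp
  \<comment> \<open>Blocks with no rows or no columns turn a row or column of blocks into a block matrix.\<close>
  define T where "T = four_block_mat T1 T' (0\<^sub>m 0 d) (0\<^sub>m 0 D')"
  define S where "S = four_block_mat S1 (0\<^sub>m d 0) S' (0\<^sub>m D' 0)"
  have Tc: "T \<in> carrier_mat e D"
    using four_block_carrier_mat[OF T1c zero_carrier_mat[of 0 D']] by (simp add: T_def D)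
  have Sc: "S \<in> carrier_mat D e"
    using four_block_carrier_mat[OF S1c zero_carrier_mat[of D' 0]] by (simp add: S_def D)
  \<comment> \<open>Padding with empty blocks makes the product rule for block matrices applicable.\<close>
  have pad: "M = four_block_mat M (0\<^sub>m k 0) (0\<^sub>m 0 l) (0\<^sub>m 0 0)" if "M \<in> carrier_mat k l"
    for k l and M :: "complex mat"
    using that by (intro eq_matI) auto
  have "S * T = four_block_mat (S1 * T1 + 0\<^sub>m d 0 * 0\<^sub>m 0 d) (S1 * T' + 0\<^sub>m d 0 * 0\<^sub>m 0 D')
      (S' * T1 + 0\<^sub>m D' 0 * 0\<^sub>m 0 d) (S' * T' + 0\<^sub>m D' 0 * 0\<^sub>m 0 D')"
    unfolding S_def T_def by (rule mult_four_block_mat[OF S1c _ S' _ T1c T']) auto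
  also have "\<dots> = 1\<^sub>m D"
    using T'_zero[OF \<sigma> ineq S1(1)] S'_zero[OF \<sigma> ineq T1(1)] by (simp add: S1 ST' D)
  finally have ST: "S * T = 1\<^sub>m D" .
  have comm: "\<tau> g * T = T * rep_sum (\<sigma> # \<sigma>s) g" if g: "g \<in> carrier G" for g
  proof -
    have gc: "\<tau> g \<in> carrier_mat e e" "\<sigma> g \<in> carrier_mat d d" "rep_sum \<sigma>s g \<in> carrier_mat D' D'"
      using rep_carrier[OF \<tau> g] rep_carrier[OF rep g] rep_sum_carrier[OF reps g] by (auto simp: D'_def)
    have "\<tau> g * T = four_block_mat (\<tau> g) (0\<^sub>m e 0) (0\<^sub>m 0 e) (0\<^sub>m 0 0) * T"
      by (rule arg_cong[OF pad[OF gc(1)], of "\<lambda>X. X * T"])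
    also have "\<dots> = four_block_mat (\<tau> g * T1 + 0\<^sub>m e 0 * 0\<^sub>m 0 d) (\<tau> g * T' + 0\<^sub>m e 0 * 0\<^sub>m 0 D')
        (0\<^sub>m 0 e * T1 + 0\<^sub>m 0 0 * 0\<^sub>m 0 d) (0\<^sub>m 0 e * T' + 0\<^sub>m 0 0 * 0\<^sub>m 0 D')"
      unfolding T_def by (rule mult_four_block_mat[OF gc(1) _ _ _ T1c T']) auto
    also have "\<dots> = four_block_mat (T1 * \<sigma> g) (T' * rep_sum \<sigma>s g) (0\<^sub>m 0 d) (0\<^sub>m 0 D')"
      using gc T1c T' T1(1) g comm'[OF g] by (simp add: intertwiner_def)
    also have "\<dots> = four_block_mat (T1 * \<sigma> g + T' * 0\<^sub>m D' d) (T1 * 0\<^sub>m d D' + T' * rep_sum \<sigma>s g)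
        (0\<^sub>m 0 d * \<sigma> g + 0\<^sub>m 0 D' * 0\<^sub>m D' d) (0\<^sub>m 0 d * 0\<^sub>m d D' + 0\<^sub>m 0 D' * rep_sum \<sigma>s g)"
      using gc T1c T' by simp
    also have "\<dots> = T * four_block_mat (\<sigma> g) (0\<^sub>m d D') (0\<^sub>m D' d) (rep_sum \<sigma>s g)"
      unfolding T_def by (rule mult_four_block_mat[symmetric, OF T1c T' _ _ gc(2) _ _ gc(3)]) auto
    finally show ?thesis
      using rep_sum_Cons[OF reps rep g D'_def] by simp
  qed
  have S_zero: "S * M = 0\<^sub>m D k"
    if \<rho>: "irreducible_rep G k \<rho>" "\<forall>\<sigma>'\<in>set (\<sigma> # \<sigma>s). characters_differ \<rho> \<sigma>'"
      and M: "intertwiner k e \<rho> \<tau> M" for \<rho> k M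
  proof -
    have \<rho>r: "representation G k \<rho>" and Mc: "M \<in> carrier_mat e k"
      using \<rho> M by (auto simp: irreducible_rep_def intertwiner_def)
    have "S1 * M = 0\<^sub>m d k"
      using \<rho>(2) by (intro schur_zero[OF \<rho>(1) \<sigma> intertwiner_comp[OF \<rho>r \<tau> rep M S1(1)]]) simp
    moreover have "S' * M = 0\<^sub>m D' k"
      using \<rho> M by (intro S'_zero) auto
    moreover have "S * M = four_block_mat S1 (0\<^sub>m d 0) S' (0\<^sub>m D' 0) * four_block_mat M (0\<^sub>m e 0) (0\<^sub>m 0 k) (0\<^sub>m 0 0)"
      unfolding S_def by (rule arg_cong[OF pad[OF Mc]])
    moreover have "\<dots> = four_block_mat (S1 * M + 0\<^sub>m d 0 * 0\<^sub>m 0 k) (S1 * 0\<^sub>m e 0 + 0\<^sub>m d 0 * 0\<^sub>m 0 0)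
        (S' * M + 0\<^sub>m D' 0 * 0\<^sub>m 0 k) (S' * 0\<^sub>m e 0 + 0\<^sub>m D' 0 * 0\<^sub>m 0 0)"
      by (rule mult_four_block_mat[OF S1c _ S' _ Mc]) auto
    ultimately show ?thesis
      using S1c S' by (simp add: D)
  qed
  have T_zero: "N * T = 0\<^sub>m k D"
    if \<rho>: "irreducible_rep G k \<rho>" "\<forall>\<sigma>'\<in>set (\<sigma> # \<sigma>s). characters_differ \<rho> \<sigma>'"
      and N: "intertwiner e k \<tau> \<rho> N" for \<rho> k N
  proof -
    have \<rho>r: "representation G k \<rho>" and Nc: "N \<in> carrier_mat k e"
      using \<rho> N by (auto simp: irreducible_rep_def intertwiner_def)
    have "N * T1 = 0\<^sub>m k d"
      using \<rho>(2) characters_differ_sym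
      by (intro schur_zero[OF \<sigma> \<rho>(1) intertwiner_comp[OF rep \<tau> \<rho>r T1(1) N]]) simp
    moreover have "N * T' = 0\<^sub>m k D'"
      using \<rho> N by (intro T'_zero) auto
    moreover have "N * T = four_block_mat N (0\<^sub>m k 0) (0\<^sub>m 0 e) (0\<^sub>m 0 0) * four_block_mat T1 T' (0\<^sub>m 0 d) (0\<^sub>m 0 D')"
      unfolding T_def by (rule arg_cong[OF pad[OF Nc], of "\<lambda>X. X * _"])
    moreover have "\<dots> = four_block_mat (N * T1 + 0\<^sub>m k 0 * 0\<^sub>m 0 d) (N * T' + 0\<^sub>m k 0 * 0\<^sub>m 0 D')
        (0\<^sub>m 0 e * T1 + 0\<^sub>m 0 0 * 0\<^sub>m 0 d) (0\<^sub>m 0 e * T' + 0\<^sub>m 0 0 * 0\<^sub>m 0 D')"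
      by (rule mult_four_block_mat[OF Nc _ _ _ T1c T']) auto
    ultimately show ?thesis
      using T1c T' by (simp add: D)
  qed
  show ?case
  proof (intro exI conjI ballI allI impI)
    show "T \<in> carrier_mat e D" "S \<in> carrier_mat D e" "S * T = 1\<^sub>m D"
      by (fact Tc Sc ST)+
    show "\<tau> g * T = T * rep_sum (\<sigma> # \<sigma>s) g" if "g \<in> carrier G" for g
      by (rule comm[OF that])
    show "S * M = 0\<^sub>m D k"
      if "irreducible_rep G k \<rho> \<and> (\<forall>\<sigma>'\<in>set (\<sigma> # \<sigma>s). characters_differ \<rho> \<sigma>')" "intertwiner k e \<rho> \<tau> M"
      for \<rho> k M
      by (rule S_zero[OF that(1)[THEN conjunct1] that(1)[THEN conjunct2] that(2)])
    show "N * T = 0\<^sub>m k D"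
      if "irreducible_rep G k \<rho> \<and> (\<forall>\<sigma>'\<in>set (\<sigma> # \<sigma>s). characters_differ \<rho> \<sigma>')" "intertwiner e k \<tau> \<rho> N"
      for \<rho> k N
      by (rule T_zero[OF that(1)[THEN conjunct1] that(1)[THEN conjunct2] that(2)])
  qed
qed

text \<open>The sum of the dimensions equals \<open>e\<close>, as the characters at the identity show. Hence the
  matrices assembled from the constituents are square and the one-sided inverse is two-sided.\<close>
theorem multiplicity_free_decomposition:
  assumes \<tau>: "representation G e \<tau>"
    and irr: "\<And>\<sigma>. \<sigma> \<in> set \<sigma>s \<Longrightarrow> \<exists>d. irreducible_rep G d \<sigma>" and ineq: "sorted_wrt characters_differ \<sigma>s"
    and char: "\<And>g. g \<in> carrier G \<Longrightarrow> character \<tau> g = (\<Sum>\<sigma>\<leftarrow>\<sigma>s. character \<sigma> g)"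
  shows "rep_equiv G \<tau> (rep_sum \<sigma>s)"
proof -
  define D where "D = (\<Sum>\<sigma>\<leftarrow>\<sigma>s. rep_dim \<sigma>)"
  have reps: "\<And>\<sigma>. \<sigma> \<in> set \<sigma>s \<Longrightarrow> \<exists>d. representation G d \<sigma>"
    using irr by (force simp: irreducible_rep_def)
  have char_one: "character \<sigma> \<one> = of_nat d" if "representation G d \<sigma>" for \<sigma> d
    using rep_one[OF that] by (simp add: character_def mat_trace_def)
  have dims: "(\<Sum>\<sigma>\<leftarrow>\<rho>s. character \<sigma> \<one>) = of_nat (\<Sum>\<sigma>\<leftarrow>\<rho>s. rep_dim \<sigma>)"
    if "\<And>\<sigma>. \<sigma> \<in> set \<rho>s \<Longrightarrow> \<exists>d. representation G d \<sigma>" for \<rho>s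
    using that
  proof (induction \<rho>s)
    case (Cons \<rho> \<rho>s)
    obtain d where d: "representation G d \<rho>"
      using Cons.prems[of \<rho>] by auto
    have "(\<Sum>\<sigma>\<leftarrow>\<rho>s. character \<sigma> \<one>) = of_nat (\<Sum>\<sigma>\<leftarrow>\<rho>s. rep_dim \<sigma>)"
      by (rule Cons.IH, rule Cons.prems) simp
    then show ?case
      by (simp add: char_one[OF d] rep_dim_eq[OF d])
  qed simp
  have "of_nat e = character \<tau> \<one>"
    by (rule char_one[OF \<tau>, symmetric])
  also have "\<dots> = of_nat D"
    unfolding char[OF one_closed] D_def by (rule dims[OF reps])
  finally have "of_nat e = (of_nat D :: complex)" .
  then have "D = e"
    by simp
  have "char_prod (character \<tau>) (character \<sigma>) \<noteq> 0" if "\<sigma> \<in> set \<sigma>s" for \<sigma>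
  proof -
    have "char_prod (character \<tau>) (character \<sigma>)
        = char_prod (\<lambda>g. \<Sum>\<sigma>\<leftarrow>\<sigma>s. character \<sigma> g) (character \<sigma>)"
      unfolding char_prod_def by (intro sum.cong refl) (simp only: char)
    also have "\<dots> = of_nat (card (carrier G))"
      by (rule char_prod_constituent[OF irr ineq that])
    finally show ?thesis
      using finite_carrier one_closed by auto
  qed
  then obtain T S where T: "T \<in> carrier_mat e e" and S: "S \<in> carrier_mat e e" and ST: "S * T = 1\<^sub>m e"
    and comm: "\<forall>g\<in>carrier G. \<tau> g * T = T * rep_sum \<sigma>s g"
    using assemble_constituents[OF \<tau> irr ineq _ D_def] unfolding \<open>D = e\<close> by blast
  have TS: "T * S = 1\<^sub>m e"
    by (rule mat_mult_left_right_inverse[OF S T ST])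
  show ?thesis
    unfolding rep_equiv_def
  proof (intro exI ballI)
    fix g assume g: "g \<in> carrier G"
    have gc: "\<tau> g \<in> carrier_mat e e" "rep_sum \<sigma>s g \<in> carrier_mat e e"
      using rep_carrier[OF \<tau> g] rep_sum_carrier[of \<sigma>s, OF reps g] unfolding D_def[symmetric] \<open>D = e\<close> by auto
    have "\<tau> g = \<tau> g * (T * S)"
      using gc by (simp add: TS)
    also have "\<dots> = \<tau> g * T * S"
      using gc T S by (intro assoc_mult_mat[symmetric]) auto
    finally have "\<tau> g = T * rep_sum \<sigma>s g * S"
      using comm g by simp
    then show "similar_mat_wit (\<tau> g) (rep_sum \<sigma>s g) T S"
      by (intro similar_mat_witI[OF TS ST]) (use gc T S in auto)
  qed
qed

end

section \<open>Tensor products and equivalence\<close>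

lemma dim_kronecker [simp]:
  "dim_row (kronecker M N) = dim_row M * dim_row N"
  "dim_col (kronecker M N) = dim_col M * dim_col N"
  by (simp_all add: kronecker_def)

text \<open>Summation over the row-major numbering of pairs by which \<open>kronecker\<close> encodes its indices.\<close>
lemma sum_lessThan_mult_div_mod:
  fixes f :: "nat \<Rightarrow> nat \<Rightarrow> 'a :: comm_monoid_add"
  shows "(\<Sum>k<m * n. f (k div n) (k mod n)) = (\<Sum>i<m. \<Sum>j<n. f i j)"
proof (cases "n = 0")
  case False
  then have n: "n > 0"
    by simp
  have "(\<Sum>k<m * n. f (k div n) (k mod n)) = (\<Sum>(i, j)\<in>{..<m} \<times> {..<n}. f i j)"
  proof (rule sum.reindex_bij_witness[where i = "\<lambda>(i, j). i * n + j" and j = "\<lambda>k. (k div n, k mod n)"])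
    show "(k div n, k mod n) \<in> {..<m} \<times> {..<n}" if "k \<in> {..<m * n}" for k
      using that n by (simp add: less_mult_imp_div_less)
    show "(case p of (i, j) \<Rightarrow> i * n + j) \<in> {..<m * n}" if mem: "p \<in> {..<m} \<times> {..<n}" for p
    proof -
      obtain i j where p: "p = (i, j)" "i < m" "j < n"
        using mem by auto
      have "i * n + j < (i + 1) * n"
        using p by simp
      also have "\<dots> \<le> m * n"
        using p by (intro mult_le_mono1) simp
      finally show ?thesis
        by (simp add: p)
    qed
  qed auto
  then show ?thesis
    by (simp add: sum.cartesian_product)
qed simp

lemma kronecker_mult:
  assumes "A \<in> carrier_mat a b" "C \<in> carrier_mat b c" "B \<in> carrier_mat a' b'" "D \<in> carrier_mat b' c'"
  shows "kronecker A B * kronecker C D = kronecker (A * C) (B * D)"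
proof (rule eq_matI)
  fix i j assume "i < dim_row (kronecker (A * C) (B * D))" "j < dim_col (kronecker (A * C) (B * D))"
  then have ij: "i < a * a'" "j < c * c'"
    using assms by auto
  then have "0 < a'" "0 < c'"
    by (auto intro: Nat.gr0I)
  then have divmod: "i div a' < a" "i mod a' < a'" "j div c' < c" "j mod c' < c'"
    using ij by (auto simp: less_mult_imp_div_less)
  have "(kronecker A B * kronecker C D) $$ (i, j)
      = (\<Sum>k<b * b'. (A $$ (i div a', k div b') * B $$ (i mod a', k mod b'))
          * (C $$ (k div b', j div c') * D $$ (k mod b', j mod c')))"
    using assms ij by (simp add: scalar_prod_def atLeast0LessThan kronecker_def)
  also have "\<dots> = (\<Sum>k<b. \<Sum>l<b'. (A $$ (i div a', k) * B $$ (i mod a', l)) * (C $$ (k, j div c') * D $$ (l, j mod c')))"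
    by (rule sum_lessThan_mult_div_mod[where f = "\<lambda>k l. (A $$ (i div a', k) * B $$ (i mod a', l)) * (C $$ (k, j div c') * D $$ (l, j mod c'))"])
  also have "\<dots> = (\<Sum>k<b. A $$ (i div a', k) * C $$ (k, j div c')) * (\<Sum>l<b'. B $$ (i mod a', l) * D $$ (l, j mod c'))"
    by (simp add: sum_product mult_ac)
  also have "\<dots> = kronecker (A * C) (B * D) $$ (i, j)"
    using assms ij divmod by (simp add: scalar_prod_def atLeast0LessThan kronecker_def)
  finally show "(kronecker A B * kronecker C D) $$ (i, j) = kronecker (A * C) (B * D) $$ (i, j)" .
qed (use assms in auto)

lemma kronecker_one: "kronecker (1\<^sub>m a) (1\<^sub>m b) = 1\<^sub>m (a * b)"
proof (rule eq_matI)
  fix i j assume "i < dim_row (1\<^sub>m (a * b) :: complex mat)" "j < dim_col (1\<^sub>m (a * b) :: complex mat)"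
  then have ij: "i < a * b" "j < a * b"
    by auto
  then have "0 < b"
    by (auto intro: Nat.gr0I)
  then have "i div b < a" "i mod b < b" "j div b < a" "j mod b < b"
    using ij by (auto simp: less_mult_imp_div_less)
  moreover have "i = j \<longleftrightarrow> i div b = j div b \<and> i mod b = j mod b"
    by (metis div_mult_mod_eq)
  ultimately show "kronecker (1\<^sub>m a) (1\<^sub>m b) $$ (i, j) = 1\<^sub>m (a * b) $$ (i, j)"
    using ij by (auto simp: kronecker_def)
qed auto

lemma mat_trace_kronecker:
  assumes "A \<in> carrier_mat a a" "B \<in> carrier_mat b b"
  shows "mat_trace (kronecker A B) = mat_trace A * mat_trace B"
proof -
  have "mat_trace (kronecker A B) = (\<Sum>k<a * b. A $$ (k div b, k div b) * B $$ (k mod b, k mod b))"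
    using assms by (simp add: mat_trace_def kronecker_def)
  also have "\<dots> = (\<Sum>i<a. \<Sum>j<b. A $$ (i, i) * B $$ (j, j))"
    by (rule sum_lessThan_mult_div_mod[where f = "\<lambda>i j. A $$ (i, i) * B $$ (j, j)"])
  finally show ?thesis
    using assms by (simp add: mat_trace_def sum_product)
qed

lemma (in finite_group)
  assumes "representation G a \<rho>" "representation G b \<sigma>"
  shows representation_tensor: "representation G (a * b) (rep_tensor \<rho> \<sigma>)"
    and character_tensor:
      "g \<in> carrier G \<Longrightarrow> character (rep_tensor \<rho> \<sigma>) g = character \<rho> g * character \<sigma> g"
proof -
  note c = rep_carrier[OF assms(1)] rep_carrier[OF assms(2)]
  show "representation G (a * b) (rep_tensor \<rho> \<sigma>)"
  proof (rule representationI)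
    fix g h assume gh: "g \<in> carrier G" "h \<in> carrier G"
    show "rep_tensor \<rho> \<sigma> g \<in> carrier_mat (a * b) (a * b)"
      using c[OF gh(1)] by (auto simp: rep_tensor_def)
    show "rep_tensor \<rho> \<sigma> (g \<otimes> h) = rep_tensor \<rho> \<sigma> g * rep_tensor \<rho> \<sigma> h"
      using c gh by (simp add: rep_tensor_def rep_mult[OF assms(1)] rep_mult[OF assms(2)]
          kronecker_mult[of _ a a _ a _ b b _ b])
  qed (simp add: rep_tensor_def rep_one[OF assms(1)] rep_one[OF assms(2)] kronecker_one)
  show "character (rep_tensor \<rho> \<sigma>) g = character \<rho> g * character \<sigma> g" if "g \<in> carrier G"
    using c[OF that] by (simp add: character_def rep_tensor_def mat_trace_kronecker)
qed

lemma rep_equiv_cong: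
  assumes "\<And>g. g \<in> carrier G \<Longrightarrow> \<rho> g = \<rho>' g" "\<And>g. g \<in> carrier G \<Longrightarrow> \<sigma> g = \<sigma>' g"
  shows "rep_equiv G \<rho> \<sigma> \<longleftrightarrow> rep_equiv G \<rho>' \<sigma>'"
  unfolding rep_equiv_def using assms by simp

lemma rep_equiv_Res: "rep_equiv H (Res H \<rho>) \<sigma> \<longleftrightarrow> rep_equiv H \<rho> \<sigma>"
  by (rule rep_equiv_cong) (auto simp: Res_def)

lemma rep_equiv_sym: "rep_equiv G \<rho> \<sigma> \<Longrightarrow> rep_equiv G \<sigma> \<rho>"
  unfolding rep_equiv_def using similar_mat_wit_sym by blast

lemma rep_equiv_trans: 
  assumes "rep_equiv G \<rho> \<sigma>" "rep_equiv G \<sigma> \<tau>"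
  shows "rep_equiv G \<rho> \<tau>"
proof -
  obtain P Q P' Q' where "\<forall>g\<in>carrier G. similar_mat_wit (\<rho> g) (\<sigma> g) P Q"
    "\<forall>g\<in>carrier G. similar_mat_wit (\<sigma> g) (\<tau> g) P' Q'"
    using assms unfolding rep_equiv_def by blast
  then have "\<forall>g\<in>carrier G. similar_mat_wit (\<rho> g) (\<tau> g) (P * P') (Q' * Q)"
    using similar_mat_wit_trans by blast
  then show ?thesis
    unfolding rep_equiv_def by blast
qed

section \<open>Characters of the Clifford groups\<close>

lemma finite_X_set [simp]: "finite (X_set n)"
  by (simp add: X_set_def)

lemma finite_group_CL: "finite_group (CL n)"
  using group_CL[of n] by (auto simp: finite_group_def finite_group_axioms_def CL_def)

interpretation CL: finite_group "CL n" for n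
  by (rule finite_group_CL)

lemma carrier_CL: "carrier (CL n) = {1, -1} \<times> Pow (X_set n)"
  by (simp add: CL_def)

lemma sign_mult_sign:
  "(e, B) \<in> carrier (CL n) \<Longrightarrow> of_int e * x * (of_int e * y) = (x * y :: complex)"
  by (auto simp: carrier_CL)

lemma carrier_CL_mono: "m \<le> n \<Longrightarrow> carrier (CL m) \<subseteq> carrier (CL n)"
  by (auto simp: CL_def X_set_def)

lemma representation_CL_restrict:
  assumes "representation (CL n) d \<rho>" "m \<le> n"
  shows "representation (CL m) d \<rho>"
proof -
  have "(\<otimes>\<^bsub>CL m\<^esub>) = (\<otimes>\<^bsub>CL n\<^esub>)"
    by (simp add: CL_def)
  then show ?thesis
    using assms carrier_CL_mono[OF assms(2)] unfolding representation_def hom_def by auto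
qed

lemma rep_equiv_CL_restrict:
  "rep_equiv (CL n) \<rho> \<sigma> \<Longrightarrow> m \<le> n \<Longrightarrow> rep_equiv (CL m) \<rho> \<sigma>"
  using carrier_CL_mono unfolding rep_equiv_def by blast

lemma irreducible_chi: "irreducible_rep (CL n) 1 (chi A)"
  unfolding irreducible_rep_def
proof (intro conjI allI impI)
  show "representation (CL n) 1 (chi A)"
    by (rule representation_chi)
  fix W assume W: "VectorSpace.subspace class_ring W (module_vec TYPE(complex) 1) \<and>
    (\<forall>g\<in>carrier (CL n). \<forall>w\<in>W. chi A g *\<^sub>v w \<in> W)"
  then interpret W: LinearCombinations.submodule class_ring W "module_vec TYPE(complex) 1"
    by (simp add: VectorSpace.subspace_def)
  have sub: "W \<subseteq> carrier_vec 1" and zero: "0\<^sub>v 1 \<in> W"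
    using W.subset W.zero_closed by (simp_all add: module_vec_simps)
  show "W = {0\<^sub>v 1} \<or> W = carrier_vec 1"
  proof (cases "W \<subseteq> {0\<^sub>v 1}")
    case True
    then show ?thesis
      using zero by auto
  next
    case False
    then obtain w where w: "w \<in> W" "w \<noteq> 0\<^sub>v 1"
      by auto
    then have wc: "w \<in> carrier_vec 1"
      using sub by auto
    have "w $ 0 \<noteq> 0"
    proof
      assume "w $ 0 = 0"
      then have "w = 0\<^sub>v 1"
        using wc by (intro eq_vecI) auto
      with w show False
        by simp
    qed
    have "v \<in> W" if v: "v \<in> carrier_vec 1" for v
    proof -
      have "v = (v $ 0 / w $ 0) \<cdot>\<^sub>v w"
        using v wc \<open>w $ 0 \<noteq> 0\<close> by (intro eq_vecI) auto
      also have "\<dots> \<in> W"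
        using W.smult_closed[of "v $ 0 / w $ 0" w] w by (simp add: module_vec_simps)
      finally show ?thesis .
    qed
    with sub show ?thesis
      by auto
  qed
qed simp

lemma character_chi: "character (chi A) (e, B) = (-1) ^ card (A \<inter> B)"
  by (simp add: character_def mat_trace_def chi_def)

text \<open>Any \<open>b\<close> in exactly one of the two sets separates the characters at \<open>\<gamma>\<^bsub>{b}\<^esub>\<close>.\<close>
lemma chi_characters_differ:
  assumes "A \<subseteq> X_set n" "C \<subseteq> X_set n" "A \<noteq> C"
  shows "CL.characters_differ n (chi A) (chi C)"
proof -
  obtain b where b: "b \<in> sym_diff A C"
    using assms(3) by auto
  then have "(1, {b}) \<in> carrier (CL n)"
    using assms by (auto simp: carrier_CL)
  moreover have "character (chi A) (1, {b}) \<noteq> character (chi C) (1, {b})"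
    using b by (auto simp: character_chi)
  ultimately show ?thesis
    unfolding CL.characters_differ_def by blast
qed

lemma sorted_wrt_chi:
  "distinct Cs \<Longrightarrow> set Cs \<subseteq> Pow (X_set n) \<Longrightarrow> sorted_wrt (CL.characters_differ n) (map chi Cs)"
  by (induction Cs) (auto intro!: chi_characters_differ)

text \<open>The sum over all subsets factors as \<open>\<Prod>\<^sub>x (1 + \<epsilon>\<^sub>x)\<close> with \<open>\<epsilon>\<^sub>x = -1\<close> exactly for \<open>x \<in> B\<close>.\<close>
lemma sum_sign_Pow:
  assumes "finite X" "B \<subseteq> X"
  shows "(\<Sum>C\<in>Pow X. (-1) ^ card (C \<inter> B)) = (if B = {} then 2 ^ card X else (0 :: complex))"
proof -
  have "(-1) ^ card (C \<inter> B) = (\<Prod>x\<in>C. if x \<in> B then -1 else (1 :: complex))" if "C \<in> Pow X" for C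
    using that assms finite_subset[of C X] by (simp add: prod.If_cases)
  then have "(\<Sum>C\<in>Pow X. (-1) ^ card (C \<inter> B))
      = (\<Sum>C\<in>Pow X. (\<Prod>x\<in>C. if x \<in> B then -1 else (1 :: complex)) * (\<Prod>x\<in>X - C. 1))"
    by simp
  also have "\<dots> = (\<Prod>x\<in>X. (if x \<in> B then -1 else 1) + 1)"
    by (rule prod_add[OF assms(1), symmetric])
  also have "\<dots> = (if B = {} then 2 ^ card X else 0)"
    using assms by (auto simp: prod_zero_iff)
  finally show ?thesis .
qed

lemma rep_equiv_sum_chi:
  assumes \<tau>: "representation (CL n) d \<tau>"
    and char: "\<And>e B. (e, B) \<in> carrier (CL n) \<Longrightarrow> character \<tau> (e, B) = (if B = {} then 2 ^ n else 0)"
    and Cs: "distinct Cs" "set Cs = Pow (X_set n)"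
  shows "rep_equiv (CL n) \<tau> (rep_sum (map chi Cs))"
proof (rule CL.multiplicity_free_decomposition[OF \<tau>])
  show "\<exists>d. irreducible_rep (CL n) d \<sigma>" if "\<sigma> \<in> set (map chi Cs)" for \<sigma>
    using that irreducible_chi by auto
  show "sorted_wrt (CL.characters_differ n) (map chi Cs)"
    using Cs by (intro sorted_wrt_chi) auto
  fix g assume g: "g \<in> carrier (CL n)"
  obtain e B where eB: "g = (e, B)" "B \<subseteq> X_set n"
    using g by (auto simp: carrier_CL)
  have "(\<Sum>\<sigma>\<leftarrow>map chi Cs. character \<sigma> g) = (\<Sum>C\<in>Pow (X_set n). (-1) ^ card (C \<inter> B))"
    unfolding eB Cs(2)[symmetric] map_map o_def character_chi
    by (rule sum_list_distinct_conv_sum_set[OF Cs(1)])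
  also have "\<dots> = character \<tau> g"
    using sum_sign_Pow[OF finite_X_set eB(2)] char[of e B] g by (simp add: eB X_set_def)
  finally show "character \<tau> g = (\<Sum>\<sigma>\<leftarrow>map chi Cs. character \<sigma> g)" ..
qed

lemma chi_sum_eq: "chi_sum n = rep_sum (map chi (map set (subseqs [1..<Suc n])))"
  by (simp add: chi_sum_def o_def del: upt_Suc)

lemma rep_sum_append: "rep_sum (\<rho>s @ \<sigma>s) = rep_sum [rep_sum \<rho>s, rep_sum \<sigma>s]"
  by (rule ext) (simp add: rep_sum_def diag_block_mat_append Let_def del: diag_block_mat.simps(2)
      flip: diag_block_mat_append[of "[_]" "[_]", simplified])

section \<open>The restricted products\<close>

lemma is_rho_character:
  assumes "is_rho n \<rho>" "(e, B) \<in> carrier (CL n)"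
  shows "character \<rho> (e, B) = of_int e * (if B = {} then 2 ^ (n div 2) else 0)"
  using assms unfolding is_rho_def carrier_CL by blast

lemma is_rho_pm_character:
  assumes "is_rho_pm n s \<rho>" "(e, B) \<in> carrier (CL n)" "n > 0"
  shows "character \<rho> (e, B) = of_int e * (if B = {} then 2 ^ ((n - 1) div 2)
     else if B = X_set n then of_int s * (if even ((n - 1) div 2) then 1 else - \<i>) * 2 ^ ((n - 1) div 2)
     else 0)"
proof -
  have "X_set n \<noteq> {}"
    using assms(3) by (auto simp: X_set_def)
  then have "character \<rho> (1, B) = (if B = {} then 2 ^ ((n - 1) div 2)
     else if B = X_set n then of_int s * (if even ((n - 1) div 2) then 1 else - \<i>) * 2 ^ ((n - 1) div 2)
     else 0)"
    using assms unfolding is_rho_pm_def Let_def carrier_CL by auto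
  moreover have "character \<rho> (e, B) = of_int e * character \<rho> (1, B)"
    using assms unfolding is_rho_pm_def Let_def carrier_CL by auto
  ultimately show ?thesis
    by simp
qed

lemma is_rho_irreducible: "is_rho n \<rho> \<Longrightarrow> irreducible_rep (CL n) (2 ^ (n div 2)) \<rho>"
  by (simp add: is_rho_def)

lemma is_rho_pm_irreducible: "is_rho_pm n s \<rho> \<Longrightarrow> irreducible_rep (CL n) (2 ^ ((n - 1) div 2)) \<rho>"
  by (simp add: is_rho_pm_def Let_def)

lemma X_set_pred: "n \<ge> 1 \<Longrightarrow> n \<notin> X_set (n - 1)" "n \<ge> 1 \<Longrightarrow> X_set n = insert n (X_set (n - 1))"
  by (auto simp: X_set_def)

lemma chi_tensor_chi:
  assumes "n \<ge> 1" "A \<subseteq> X_set n" "B \<subseteq> X_set n"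
  shows "rep_equiv (CL (n - 1)) (rep_tensor (chi A) (chi B)) (chi (sym_diff A B - {n}))"
proof -
  have "rep_tensor (chi A) (chi B) g = chi (sym_diff A B - {n}) g" if g: "g \<in> carrier (CL (n - 1))" for g
  proof -
    obtain e C where C: "g = (e, C)" "C \<subseteq> X_set (n - 1)"
      using g by (auto simp: carrier_CL)
    then have "finite C" and n: "n \<notin> C"
      using X_set_pred(1)[OF assms(1)] by (auto intro: finite_subset[OF _ finite_X_set])
    have "(sym_diff A B - {n}) \<inter> C = sym_diff (A \<inter> C) (B \<inter> C)"
      using n by auto
    then have "(-1 :: complex) ^ card ((sym_diff A B - {n}) \<inter> C) = (-1) ^ card (A \<inter> C) * (-1) ^ card (B \<inter> C)"
      using \<open>finite C\<close> by (simp only: minus_one_power_card_sym_diff finite_Int simp_thms)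
    then show ?thesis
      unfolding C by (intro eq_matI) (auto simp: rep_tensor_def kronecker_def chi_def)
  qed
  then have "rep_equiv (CL (n - 1)) (rep_tensor (chi A) (chi B)) (chi (sym_diff A B - {n}))
      \<longleftrightarrow> rep_equiv (CL (n - 1)) (chi (sym_diff A B - {n})) (chi (sym_diff A B - {n}))"
    by (intro rep_equiv_cong) auto
  moreover have "similar_mat_wit (chi C g) (chi C g) (1\<^sub>m 1) (1\<^sub>m 1)" for C g
    by (rule similar_mat_wit_refl) (auto simp: chi_def split: prod.splits)
  ultimately show ?thesis
    unfolding rep_equiv_def by blast
qed

text \<open>The sign \<open>(-1)\<^bsup>|A \<inter> B|\<^esup>\<close> is invisible because the character of \<open>\<rho>\<close> vanishes unless \<open>B = \<emptyset>\<close>. The values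
  of \<open>\<rho>p\<close> and \<open>\<rho>m\<close> at the top element are opposite and nonzero, so they cancel in the sum and also
  show that the two characters differ.\<close>
lemma chi_tensor_rho_even:
  assumes n: "n \<ge> 1" "even n" and \<rho>: "is_rho n \<rho>"
    and pm: "is_rho_pm (n - 1) 1 \<rho>p" "is_rho_pm (n - 1) (-1) \<rho>m"
  shows "rep_equiv (CL (n - 1)) (rep_tensor (chi A) \<rho>) (rep_sum [\<rho>p, \<rho>m])"
proof -
  have n1: "n - 1 > 0"
    using n by (cases "n = 1") auto
  have rep: "representation (CL n) (2 ^ (n div 2)) \<rho>"
    using is_rho_irreducible[OF \<rho>] by (simp add: irreducible_rep_def)
  have two: "(2 :: complex) ^ (n div 2) = 2 * 2 ^ ((n - 1 - 1) div 2)"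
  proof -
    have "n div 2 = Suc ((n - 1 - 1) div 2)"
      using n n1 by presburger
    then show ?thesis
      by simp
  qed
  have "CL.characters_differ (n - 1) \<rho>p \<rho>m"
    unfolding CL.characters_differ_def
  proof
    show X: "(1, X_set (n - 1)) \<in> carrier (CL (n - 1))"
      by (simp add: carrier_CL)
    have "X_set (n - 1) \<noteq> {}"
      using n1 by (auto simp: X_set_def)
    then show "character \<rho>p (1, X_set (n - 1)) \<noteq> character \<rho>m (1, X_set (n - 1))"
      unfolding is_rho_pm_character[OF pm(1) X n1] is_rho_pm_character[OF pm(2) X n1] by simp
  qed
  moreover have "character (rep_tensor (chi A) \<rho>) g = (\<Sum>\<sigma>\<leftarrow>[\<rho>p, \<rho>m]. character \<sigma> g)"
    if g: "g \<in> carrier (CL (n - 1))" for g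
  proof -
    obtain e B where eB: "g = (e, B)"
      by (cases g)
    have gn: "(e, B) \<in> carrier (CL n)"
      using g carrier_CL_mono[of "n - 1" n] by (auto simp: eB)
    show ?thesis
      using two unfolding eB CL.character_tensor[OF representation_chi rep gn] is_rho_character[OF \<rho> gn]
      by (simp add: is_rho_pm_character[OF pm(1) g[unfolded eB] n1] is_rho_pm_character[OF pm(2) g[unfolded eB] n1]
          character_chi)
  qed
  ultimately show ?thesis
    using is_rho_pm_irreducible[OF pm(1)] is_rho_pm_irreducible[OF pm(2)]
    by (intro CL.multiplicity_free_decomposition
        [OF representation_CL_restrict[OF CL.representation_tensor[OF representation_chi rep]]]) auto
qed

text \<open>The only nonzero value of the character of \<open>\<rho>\<close> away from \<open>\<plusminus>\<gamma>\<^sub>\<emptyset>\<close> is at \<open>\<plusminus>\<gamma>\<^bsub>X\<^esub>\<close>, which lies outside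
  \<open>CL (n - 1)\<close>; it is also the only place where the sign \<open>s\<close> enters.\<close>
lemma chi_tensor_rho_odd:
  assumes n: "odd n" and \<rho>: "is_rho_pm n s \<rho>" and \<sigma>: "is_rho (n - 1) \<sigma>"
  shows "rep_equiv (CL (n - 1)) (rep_tensor (chi A) \<rho>) \<sigma>"
proof -
  have n0: "n > 0"
    using n by (rule odd_pos)
  have rep: "representation (CL n) (2 ^ ((n - 1) div 2)) \<rho>"
    using is_rho_pm_irreducible[OF \<rho>] by (simp add: irreducible_rep_def)
  have "character (rep_tensor (chi A) \<rho>) g = (\<Sum>\<sigma>\<leftarrow>[\<sigma>]. character \<sigma> g)"
    if g: "g \<in> carrier (CL (n - 1))" for g
  proof -
    obtain e B where eB: "g = (e, B)" "B \<subseteq> X_set (n - 1)"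
      using g by (auto simp: carrier_CL)
    have gn: "(e, B) \<in> carrier (CL n)"
      using g carrier_CL_mono[of "n - 1" n] by (auto simp: eB)
    have "B \<noteq> X_set n"
      using X_set_pred[of n] n0 eB(2) by auto
    then show ?thesis
      unfolding eB CL.character_tensor[OF representation_chi rep gn] is_rho_pm_character[OF \<rho> gn n0]
      by (simp add: is_rho_character[OF \<sigma> g[unfolded eB]] character_chi)
  qed
  then have "rep_equiv (CL (n - 1)) (rep_tensor (chi A) \<rho>) (rep_sum [\<sigma>])"
    using is_rho_irreducible[OF \<sigma>]
    by (intro CL.multiplicity_free_decomposition
        [OF representation_CL_restrict[OF CL.representation_tensor[OF representation_chi rep]]]) auto
  moreover have "rep_sum [\<sigma>] = \<sigma>"
    by (rule ext) (simp add: rep_sum_def del: diag_block_mat.simps)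
  ultimately show ?thesis
    by simp
qed

text \<open>The decomposition is multiplicity-free over \<open>CL n\<close>. The list of subsets of \<open>X_set n\<close> is arranged as
  those without \<open>n\<close> followed by the same ones with \<open>n\<close> added, so that on restriction it becomes the
  list for \<open>n - 1\<close> written twice.\<close>
lemma rho_tensor_rho_even:
  assumes n: "n \<ge> 1" "even n" and \<rho>: "is_rho n \<rho>"
  shows "rep_equiv (CL (n - 1)) (rep_tensor \<rho> \<rho>) (rep_sum [chi_sum (n - 1), chi_sum (n - 1)])"
proof -
  define Cs where "Cs = map set (subseqs [1..<Suc (n - 1)])"
  have Cs: "set Cs = Pow (X_set (n - 1))" "distinct Cs"
    unfolding Cs_def by (rule chi_sum_index)+
  have nC: "n \<notin> C" if "C \<in> set Cs" for C
    using that Cs X_set_pred(1)[OF n(1)] by auto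
  have rep: "representation (CL n) (2 ^ (n div 2)) \<rho>"
    using is_rho_irreducible[OF \<rho>] by (simp add: irreducible_rep_def)
  have "rep_equiv (CL n) (rep_tensor \<rho> \<rho>) (rep_sum (map chi (Cs @ map (insert n) Cs)))"
  proof (rule rep_equiv_sum_chi[OF CL.representation_tensor[OF rep rep]])
    fix e B assume g: "(e, B) \<in> carrier (CL n)"
    have "n div 2 + n div 2 = n"
      using n by auto
    then show "character (rep_tensor \<rho> \<rho>) (e, B) = (if B = {} then 2 ^ n else 0)"
      by (simp add: CL.character_tensor[OF rep rep g] is_rho_character[OF \<rho> g] sign_mult_sign[OF g]
          flip: power_add)
  next
    have "inj_on (insert n) (set Cs)"
      using nC by (intro inj_onI) (metis Diff_insert_absorb)
    then show "distinct (Cs @ map (insert n) Cs)"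
      using Cs nC by (auto simp: distinct_map)
    show "set (Cs @ map (insert n) Cs) = Pow (X_set n)"
      by (simp add: Cs X_set_pred(2)[OF n(1)] Pow_insert)
  qed
  then have "rep_equiv (CL (n - 1)) (rep_tensor \<rho> \<rho>) (rep_sum (map chi (Cs @ map (insert n) Cs)))"
    by (rule rep_equiv_CL_restrict) simp
  moreover have "rep_sum (map chi (Cs @ map (insert n) Cs)) g = rep_sum [chi_sum (n - 1), chi_sum (n - 1)] g"
    if g: "g \<in> carrier (CL (n - 1))" for g
  proof -
    obtain e B where eB: "g = (e, B)" "B \<subseteq> X_set (n - 1)"
      using g by (auto simp: carrier_CL)
    have "n \<notin> B"
      using X_set_pred(1)[OF n(1)] eB(2) by auto
    then have "rep_sum (map chi (Cs @ map (insert n) Cs)) g = rep_sum (map chi Cs @ map chi Cs) g"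
      by (simp add: eB chi_def rep_sum_def o_def)
    then show ?thesis
      by (simp add: rep_sum_append chi_sum_eq Cs_def del: upt_Suc)
  qed
  ultimately show ?thesis
    using rep_equiv_cong[of "CL (n - 1)" "rep_tensor \<rho> \<rho>" "rep_tensor \<rho> \<rho>"] by blast
qed

text \<open>As the signs \<open>s\<close> and \<open>s'\<close> matter only at the top element of \<open>CL n\<close>, one statement covers equal and
  opposite signs.\<close>
lemma rho_tensor_rho_odd:
  assumes n: "odd n" and \<rho>: "is_rho_pm n s \<rho>" "is_rho_pm n s' \<rho>'"
  shows "rep_equiv (CL (n - 1)) (rep_tensor \<rho> \<rho>') (chi_sum (n - 1))"
  unfolding chi_sum_eq
proof (rule rep_equiv_sum_chi)
  have n0: "n > 0"
    using n by (rule odd_pos)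
  have rep: "representation (CL n) (2 ^ ((n - 1) div 2)) \<rho>" "representation (CL n) (2 ^ ((n - 1) div 2)) \<rho>'"
    using \<rho>[THEN is_rho_pm_irreducible] by (auto simp: irreducible_rep_def)
  show "representation (CL (n - 1)) (2 ^ ((n - 1) div 2) * 2 ^ ((n - 1) div 2)) (rep_tensor \<rho> \<rho>')"
    by (intro representation_CL_restrict[OF CL.representation_tensor[OF rep]]) simp
  fix e B assume g: "(e, B) \<in> carrier (CL (n - 1))"
  then have gn: "(e, B) \<in> carrier (CL n)"
    using carrier_CL_mono[of "n - 1" n] by auto
  have "B \<noteq> X_set n"
    using X_set_pred[of n] n0 g by (auto simp: carrier_CL)
  moreover have "(n - 1) div 2 + (n - 1) div 2 = n - 1"
    using n by (auto elim!: oddE)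
  ultimately show "character (rep_tensor \<rho> \<rho>') (e, B) = (if B = {} then 2 ^ (n - 1) else 0)"
    by (simp add: CL.character_tensor[OF rep gn] is_rho_pm_character[OF \<rho>(1) gn n0]
        is_rho_pm_character[OF \<rho>(2) gn n0] sign_mult_sign[OF g] flip: power_add)
qed (rule chi_sum_index)+

theorem mainTheorem3:
  fixes n :: nat and A B :: "nat set"
  assumes "n \<ge> 1" and "A \<subseteq> X_set n" and "B \<subseteq> X_set n"
  shows
    "rep_equiv (CL (n - 1)) (Res (CL (n - 1)) (rep_tensor (chi A) (chi B))) (chi (sym_diff A B - {n}))
   \<and> (even n \<longrightarrow>
        (\<forall>\<rho> \<rho>p \<rho>m. is_rho n \<rho> \<and> is_rho_pm (n - 1) 1 \<rho>p \<and> is_rho_pm (n - 1) (-1) \<rho>m \<longrightarrow>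
           rep_equiv (CL (n - 1)) (Res (CL (n - 1)) (rep_tensor (chi A) \<rho>)) (rep_sum [\<rho>p, \<rho>m])))
   \<and> (odd n \<longrightarrow>
        (\<forall>s\<in>{1, -1}. \<forall>\<rho> \<sigma>. is_rho_pm n s \<rho> \<and> is_rho (n - 1) \<sigma> \<longrightarrow>
           rep_equiv (CL (n - 1)) (Res (CL (n - 1)) (rep_tensor (chi A) \<rho>)) \<sigma>))
   \<and> (even n \<longrightarrow>
        (\<forall>\<rho>. is_rho n \<rho> \<longrightarrow>
           rep_equiv (CL (n - 1)) (Res (CL (n - 1)) (rep_tensor \<rho> \<rho>))
             (rep_sum [chi_sum (n - 1), chi_sum (n - 1)])))
   \<and> (odd n \<longrightarrow>
        (\<forall>s\<in>{1, -1}. \<forall>\<rho>. is_rho_pm n s \<rho> \<longrightarrow>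
           rep_equiv (CL (n - 1)) (Res (CL (n - 1)) (rep_tensor \<rho> \<rho>)) (chi_sum (n - 1))
         \<and> (\<forall>\<rho>'. is_rho_pm n (- s) \<rho>' \<longrightarrow>
              rep_equiv (CL (n - 1)) (Res (CL (n - 1)) (rep_tensor \<rho> \<rho>))
                (Res (CL (n - 1)) (rep_tensor \<rho> \<rho>'))
            \<and> rep_equiv (CL (n - 1)) (Res (CL (n - 1)) (rep_tensor \<rho> \<rho>')) (chi_sum (n - 1)))))"
  unfolding rep_equiv_Res
proof (intro conjI impI allI ballI; (elim conjE)?)
  show "rep_equiv (CL (n - 1)) (rep_tensor (chi A) (chi B)) (chi (sym_diff A B - {n}))"
    by (rule chi_tensor_chi[OF assms])
next
  fix \<rho> \<rho>p \<rho>m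
  assume "even n" "is_rho n \<rho>" "is_rho_pm (n - 1) 1 \<rho>p" "is_rho_pm (n - 1) (-1) \<rho>m"
  with assms(1) show "rep_equiv (CL (n - 1)) (rep_tensor (chi A) \<rho>) (rep_sum [\<rho>p, \<rho>m])"
    by (rule chi_tensor_rho_even)
next
  fix s \<rho> \<sigma>
  assume "odd n" "is_rho_pm n s \<rho>" "is_rho (n - 1) \<sigma>"
  then show "rep_equiv (CL (n - 1)) (rep_tensor (chi A) \<rho>) \<sigma>"
    by (rule chi_tensor_rho_odd)
next
  fix \<rho>
  assume "even n" "is_rho n \<rho>"
  with assms(1) show "rep_equiv (CL (n - 1)) (rep_tensor \<rho> \<rho>) (rep_sum [chi_sum (n - 1), chi_sum (n - 1)])"
    by (rule rho_tensor_rho_even)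
next
  fix s \<rho>
  assume n: "odd n" and \<rho>: "is_rho_pm n s \<rho>"
  show eq: "rep_equiv (CL (n - 1)) (rep_tensor \<rho> \<rho>) (chi_sum (n - 1))"
    by (rule rho_tensor_rho_odd[OF n \<rho> \<rho>])
  fix \<rho>'
  assume \<rho>': "is_rho_pm n (- s) \<rho>'"
  show eq': "rep_equiv (CL (n - 1)) (rep_tensor \<rho> \<rho>') (chi_sum (n - 1))"
    by (rule rho_tensor_rho_odd[OF n \<rho> \<rho>'])
  have "rep_equiv (CL (n - 1)) (rep_tensor \<rho> \<rho>) (rep_tensor \<rho> \<rho>')"
    by (rule rep_equiv_trans[OF eq rep_equiv_sym[OF eq']])
  then show "rep_equiv (CL (n - 1)) (rep_tensor \<rho> \<rho>) (Res (CL (n - 1)) (rep_tensor \<rho> \<rho>'))"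
    by (subst rep_equiv_cong[where \<sigma>' = "rep_tensor \<rho> \<rho>'"]) (auto simp: Res_def)
qed

end
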